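(* Let $d=1$ and let $F,G$ be distribution functions on $[0,\infty)$. Then the following hold. (1) If $F\le G$ and $F(0)\ge e^{-\beta_G(1)}$, then $$-\log F(0)=\beta_F(1)=\beta_G(1)=-\log G(0).$$ In particular, if $F$ strictly dominates $G$, then $F(0)<e^{-\beta_G(1)}$ is a necessary and sufficient condition for $\beta_F(1)>\beta_G(1)$. (2) If $F$ strictly dominates $G$ and $F(0)<G(0)$, then $\beta_F(1)>\beta_G(1)$. (3) If $F$ strictly dominates $G$ and $F(0)=0$, then $\beta_F(1)>\beta_G(1)$.
   Context: $F$ strictly dominates $G$ means: $F(t)\le G(t)$ for all $t\geq 0$, but $F\not\equiv G$. Let $(S_k)_{k\ge0}$ be the simple random walk on $\mathbb{Z}$, with law $P^x$ and expectation $E^x$ when started at $x$. For a distribution function $\phi$ on $[0,\infty)$ let the potential $\omega=(\omega(x))_{x\in\mathbb{Z}}$ be i.i.d. with distribution function $\phi$, independent of the walk, with expectation $\mathbb{E}$. Let $H(y):=\inf\{k\ge0:S_k=y\}$, $$e(x,y,\omega):=E^x\Bigl[\exp\Bigl\{-\sum_{k=0}^{H(y)-1}\omega(S_k)\Bigr\}\mathbf{1}_{\{H(y)<\infty\}}\Bigr]$$ ($e(x,x,\omega):=1$) and $b_\phi(x,y):=-\log\mathbb{E}[e(x,y,\omega)]$. The annealed Lyapunov exponent satisfies $\beta_\phi(1)=\lim_{n\to\infty}\frac1n b_\phi(0,n)=\inf_{n\in\mathbb{N}}\frac1n b_\phi(0,n)$ (the limit is known to exist and be finite). *)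

theory Defs
  imports "HOL-Probability.Probability"
begin

section \<open>Distribution functions on the nonnegative half-line\<close>

text \<open>A distribution function on the half-line is represented by a function on all of
  \<open>real\<close> vanishing on the negative reals, so that \<open>interval_measure\<close> yields its law.\<close>

definition distribution_function :: "(real \<Rightarrow> real) \<Rightarrow> bool" where
  "distribution_function F \<longleftrightarrow>
     mono F \<and> (\<forall>t. continuous (at_right t) F) \<and> (\<forall>t<0. F t = 0) \<and> (F \<longlongrightarrow> 1) at_top"

text \<open>Pointwise order on \<open>t \<ge> 0\<close>. Strict domination only excludes \<open>F \<equiv> G\<close>; it does not
  require strict inequality everywhere.\<close>

definition dist_le :: "(real \<Rightarrow> real) \<Rightarrow> (real \<Rightarrow> real) \<Rightarrow> bool" where
  "dist_le F G \<longleftrightarrow> (\<forall>t\<ge>0. F t \<le> G t)"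

definition strictly_dominates :: "(real \<Rightarrow> real) \<Rightarrow> (real \<Rightarrow> real) \<Rightarrow> bool" where
  "strictly_dominates F G \<longleftrightarrow> dist_le F G \<and> (\<exists>t\<ge>0. F t \<noteq> G t)"


section \<open>Simple random walk on the integers\<close>

text \<open>The sample space of the walk is the space of step sequences: the steps are i.i.d. and
  uniform on \<open>{-1, 1}\<close>. The law \<open>P\<^sup>x\<close> is that of \<open>walk x\<close> under \<open>step_measure\<close>.\<close>

definition step_measure :: "(nat \<Rightarrow> int) measure" where
  "step_measure = Pi\<^sub>M UNIV (\<lambda>_. measure_pmf (pmf_of_set {-1, 1}))"

definition walk :: "int \<Rightarrow> (nat \<Rightarrow> int) \<Rightarrow> nat \<Rightarrow> int" where
  "walk x \<xi> k = x + (\<Sum>i<k. \<xi> i)"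

definition hitting_time :: "(nat \<Rightarrow> int) \<Rightarrow> int \<Rightarrow> enat" where
  "hitting_time S y = Inf {enat k |k. S k = y}"


section \<open>Annealed Lyapunov exponent\<close>

text \<open>Bochner integrals are used throughout. The integrands are bounded by 1 as soon as
  the potential is nonnegative, which holds almost surely under \<open>potential_measure \<phi>\<close> for a
  distribution function \<open>\<phi>\<close>.\<close>

definition e_hit :: "int \<Rightarrow> int \<Rightarrow> (int \<Rightarrow> real) \<Rightarrow> real" where
  "e_hit x y \<omega> =
     (\<integral>\<xi>. (let S = walk x \<xi>; H = hitting_time S y in
            if H < \<infinity> then exp (- (\<Sum>k<the_enat H. \<omega> (S k))) else 0) \<partial>step_measure)"

definition potential_measure :: "(real \<Rightarrow> real) \<Rightarrow> (int \<Rightarrow> real) measure" where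
  "potential_measure \<phi> = Pi\<^sub>M UNIV (\<lambda>_. interval_measure \<phi>)"

definition annealed_cost :: "(real \<Rightarrow> real) \<Rightarrow> int \<Rightarrow> int \<Rightarrow> real" where
  "annealed_cost \<phi> x y = - ln (\<integral>\<omega>. e_hit x y \<omega> \<partial>potential_measure \<phi>)"

text \<open>The exponent \<open>\<beta>\<^sub>\<phi>(1)\<close>.\<close>

definition annealed_lyapunov :: "(real \<Rightarrow> real) \<Rightarrow> real" where
  "annealed_lyapunov \<phi> = lim (\<lambda>n. annealed_cost \<phi> 0 (int n) / real n)"

lemma prob_space_step_measure: "prob_space step_measure"
  unfolding step_measure_def by (intro prob_space_PiM measure_pmf.prob_space_axioms)

lemma e_hit_same: "e_hit x x \<omega> = 1"
proof -
  interpret prob_space step_measure by (rule prob_space_step_measure)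
  have "hitting_time (walk x \<xi>) x = 0" for \<xi>
  proof -
    have "enat 0 \<in> {enat k |k. walk x \<xi> k = x}" by (auto simp: walk_def)
    then have "hitting_time (walk x \<xi>) x \<le> enat 0"
      unfolding hitting_time_def by (rule Inf_lower)
    then show ?thesis by (simp add: zero_enat_def[symmetric])
  qed
  then show ?thesis
    unfolding e_hit_def Let_def
    by (simp only: zero_enat_def enat_ord_simps the_enat.simps) (simp add: prob_space)
qed

lemma prob_space_potential_measure:
  assumes "distribution_function \<phi>"
  shows "prob_space (potential_measure \<phi>)"
  unfolding potential_measure_def
proof (intro prob_space_PiM)
  have "(\<phi> \<longlongrightarrow> 0) at_bot"
    using assms unfolding distribution_function_def
    by (intro tendsto_eventually) (auto simp: eventually_at_bot_dense)
  then have "real_distribution (interval_measure \<phi>)"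
    using assms by (intro real_distribution_interval_measure) (auto simp: distribution_function_def mono_def)
  then show "prob_space (interval_measure \<phi>)"
    by (simp add: real_distribution_def)
qed

end

theory Submission
  imports Defs "HOL-Real_Asymp.Real_Asymp"
begin

text \<open>
  Averaging over the potential first, a first-passage path from 0 to \<open>n\<close> that visits the site \<open>x\<close>
  exactly \<open>l(x)\<close> times has the weight \<open>2 ^ (- length)\<close> times the product of \<open>L(l(x))\<close> over the
  visited sites, where \<open>L(k)\<close> is the mean of \<open>exp (- k t)\<close> under \<open>\<phi>\<close> (\<open>laplace\<close>). The mean of
  \<open>e(0, n, \<omega>)\<close> is the sum \<open>a\<^sub>n\<close> of these weights (\<open>annealed_cost_eq\<close>), so everything can be read off
  from \<open>L\<close>. Since \<open>L(j + k) \<ge> L(j) L(k)\<close>, concatenation of paths gives \<open>a\<^bsub>m+n\<^esub> \<ge> a\<^sub>m a\<^sub>n\<close>; by Fekete's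
  lemma the exponent \<open>\<beta>\<close> exists as a limit and \<open>a\<^sub>n \<le> exp (- \<beta> n)\<close> for all \<open>n > 0\<close>.

  Three comparisons then prove the theorem. Firstly, \<open>L\<close> is monotone in \<open>\<phi>\<close>, hence so is the
  exponent (\<open>annealed_lyapunov_mono\<close>). Secondly, \<open>\<beta> \<le> - ln (\<phi> 0)\<close>
  (\<open>annealed_lyapunov_le_atom\<close>): let the potential vanish on \<open>{0, \<dots>, n - 1}\<close> and the walk reach \<open>n\<close>
  before \<open>-1\<close>, which has probability \<open>\<phi> 0 ^ n / (n + 1)\<close> by gambler's ruin. These two facts squeeze
  both exponents when \<open>F 0 \<ge> exp (- \<beta>\<^sub>G)\<close>.

  Thirdly, if \<open>F\<close> strictly dominates \<open>G\<close> and \<open>F 0 < c\<close> with \<open>c = exp (- \<beta>\<^sub>G)\<close>, then the exponents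
  differ (\<open>annealed_lyapunov_strict_mono\<close>). The ratio of \<open>L\<^sub>F(k)\<close> to \<open>L\<^sub>G(k)\<close> is less than 1 for each
  \<open>k > 0\<close> but may tend to 1 as \<open>k\<close> grows; however, \<open>L\<^sub>F(k)\<close> then tends to \<open>F 0 < c\<close>. Both cases are
  captured by one estimate \<open>L\<^sub>F(k) \<le> \<sigma> L\<^sub>G(k) ^ \<theta> c ^ (1 - \<theta>)\<close> with \<open>\<sigma>, \<theta> < 1\<close>
  (\<open>laplace_gap\<close>). As a path to \<open>n\<close> visits at least \<open>n\<close> sites, multiplying over the sites gives
  \<open>a\<^sub>n(F) \<le> \<sigma> ^ n (a\<^sub>n(G) + c ^ n) \<le> 2 (\<sigma> c) ^ n\<close>.
\<close>

section \<open>Laplace transforms of distribution functions\<close>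

definition laplace :: "(real \<Rightarrow> real) \<Rightarrow> nat \<Rightarrow> real" where
  "laplace \<phi> k = (\<integral>t. exp (- real k * t) \<partial>interval_measure \<phi>)"

context
  fixes \<phi> :: "real \<Rightarrow> real"
  assumes df: "distribution_function \<phi>"
begin

lemma prob_space_law: "prob_space (interval_measure \<phi>)"
  and emeasure_law_atMost: "emeasure (interval_measure \<phi>) {..t} = ennreal (\<phi> t)"
  and measure_law_atMost: "measure (interval_measure \<phi>) {..t} = \<phi> t"
proof -
  have bot: "(\<phi> \<longlongrightarrow> 0) at_bot"
    using df unfolding distribution_function_def
    by (intro tendsto_eventually) (auto simp: eventually_at_bot_dense)
  then have "real_distribution (interval_measure \<phi>)"
    using df by (intro real_distribution_interval_measure)
      (auto simp: distribution_function_def mono_def)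
  then show "prob_space (interval_measure \<phi>)"
    by (simp add: real_distribution_def)
  show "emeasure (interval_measure \<phi>) {..t} = ennreal (\<phi> t)"
    "measure (interval_measure \<phi>) {..t} = \<phi> t"
    using df bot
    by (auto intro!: emeasure_interval_measure_Iic measure_interval_measure_Iic
        simp: distribution_function_def mono_def)
qed

interpretation law: prob_space "interval_measure \<phi>"
  by (rule prob_space_law)

lemma distribution_function_range: "0 \<le> \<phi> t" "\<phi> t \<le> 1"
  using measure_law_atMost[of t] law.prob_le_1[of "{..t}"] by (metis measure_nonneg, metis)

lemma AE_law_nonneg: "AE t in interval_measure \<phi>. 0 \<le> t"
proof -
  \<comment> \<open>The half-line below 0 is exhausted by countably many closed half-lines of measure 0.\<close>
  define N where "N = (\<Union>n::nat. {.. - (1 / real (Suc n))})"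
  have "emeasure (interval_measure \<phi>) {.. - (1 / real (Suc n))} = 0" for n
    using df by (subst emeasure_law_atMost) (auto simp: distribution_function_def)
  then have "N \<in> null_sets (interval_measure \<phi>)"
    unfolding N_def by (intro null_sets_UN) (auto simp: null_sets_def)
  moreover have "{t \<in> space (interval_measure \<phi>). \<not> 0 \<le> t} \<subseteq> N"
  proof
    fix t assume "t \<in> {t \<in> space (interval_measure \<phi>). \<not> 0 \<le> t}"
    then have "0 < - t" by simp
    then obtain n where "inverse (real (Suc n)) < - t" using reals_Archimedean by blast
    then have "t \<in> {.. - (1 / real (Suc n))}" by (simp add: inverse_eq_divide)
    then show "t \<in> N" unfolding N_def by blast
  qed
  ultimately show ?thesis by (rule AE_I')
qed

lemma integrable_exp_law [simp]: "integrable (interval_measure \<phi>) (\<lambda>t. exp (- (real k * t)))"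
proof (rule law.integrable_const_bound[where B = 1])
  show "AE t in interval_measure \<phi>. norm (exp (- (real k * t))) \<le> 1"
    using AE_law_nonneg by eventually_elim simp
qed measurable

lemma laplace_0 [simp]: "laplace \<phi> 0 = 1"
  by (simp add: laplace_def law.prob_space[simplified])

lemma laplace_pos: "0 < laplace \<phi> k"
proof -
  have "laplace \<phi> k \<noteq> 0"
  proof
    assume "laplace \<phi> k = 0"
    then have "AE t in interval_measure \<phi>. exp (- (real k * t)) = 0"
      unfolding laplace_def
      by (subst (asm) integral_nonneg_eq_0_iff_AE) auto
    then have "AE t in interval_measure \<phi>. False" by eventually_elim simp
    then show False by simp
  qed
  moreover have "0 \<le> laplace \<phi> k" by (simp add: laplace_def)
  ultimately show ?thesis by simp
qed

lemma laplace_antimono: "j \<le> k \<Longrightarrow> laplace \<phi> k \<le> laplace \<phi> j"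
  unfolding laplace_def
  using AE_law_nonneg
  by (intro integral_mono_AE) (auto elim!: eventually_mono intro!: mult_right_mono)

lemma laplace_le_1: "laplace \<phi> k \<le> 1"
  using laplace_antimono[of 0 k] by simp

text \<open>A site of potential zero costs nothing, however often it is visited.\<close>

lemma laplace_ge_atom: "\<phi> 0 \<le> laplace \<phi> k"
proof -
  have "\<phi> 0 = (\<integral>t. indicator {..0} t \<partial>interval_measure \<phi>)"
    by (simp add: measure_law_atMost)
  also have "\<dots> \<le> laplace \<phi> k"
    unfolding laplace_def
    by (intro integral_mono_AE)
       (use AE_law_nonneg in \<open>auto elim!: eventually_mono split: split_indicator simp: law.emeasure_eq_measure\<close>)
  finally show ?thesis .
qed

text \<open>Many visits to a site are affordable only where the potential vanishes. This limit is what
  makes the comparison of \<open>F 0\<close> with the exponent of \<open>G\<close> decisive.\<close>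

lemma laplace_tendsto_atom: "laplace \<phi> \<longlonglongrightarrow> \<phi> 0"
proof -
  have lim: "(\<lambda>k. exp (- real k * t)) \<longlonglongrightarrow> indicator {..0} t" if "0 \<le> t" for t :: real
  proof (cases "t = 0")
    case False
    with that have "0 < t" by simp
    then have "(\<lambda>k. exp (- t) ^ k) \<longlonglongrightarrow> 0"
      by (intro LIMSEQ_realpow_zero) auto
    with \<open>0 < t\<close> show ?thesis
      by (simp add: exp_of_nat_mult[symmetric])
  qed simp
  have "(\<lambda>k. \<integral>t. exp (- real k * t) \<partial>interval_measure \<phi>)
      \<longlonglongrightarrow> (\<integral>t. indicator {..0} t \<partial>interval_measure \<phi>)"
  proof (rule integral_dominated_convergence[where w = "\<lambda>_. 1"])
    show "AE t in interval_measure \<phi>. (\<lambda>k. exp (- real k * t)) \<longlonglongrightarrow> indicator {..0} t"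
      using AE_law_nonneg by eventually_elim (rule lim)
    show "AE t in interval_measure \<phi>. norm (exp (- real k * t)) \<le> 1" for k
      using AE_law_nonneg by eventually_elim simp
  qed auto
  then show ?thesis
    by (simp add: laplace_def[abs_def] measure_law_atMost)
qed

text \<open>Both exponentials are decreasing in the potential, hence positively correlated
  (Chebyshev's association inequality). One integral suffices: if the first exponential attains
  its mean \<open>c\<close> at \<open>s\<close>, and \<open>d\<close> is the value of the second at \<open>s\<close>, then the two differences from
  \<open>c\<close> and \<open>d\<close> have the same sign at every point, and integrating their product gives the claim.\<close>

lemma laplace_supermultiplicative: "laplace \<phi> j * laplace \<phi> k \<le> laplace \<phi> (j + k)"
proof (cases "j = 0")
  case False
  define c where "c = laplace \<phi> j"
  \<comment> \<open>The point where \<open>exp (- j s) = c\<close>.\<close>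
  define s where "s = - ln c / real j"
  define d where "d = exp (- (real k * s))"
  have c: "c = exp (- (real j * s))"
    using False laplace_pos[of j] by (simp add: s_def c_def)
  have *: "0 \<le> (exp (- (real j * t)) - c) * (exp (- (real k * t)) - d)" for t
  proof (cases "t \<le> s")
    case True
    then show ?thesis unfolding c d_def
      by (intro mult_nonneg_nonneg) (auto intro: mult_left_mono)
  next
    case False
    then show ?thesis unfolding c d_def
      by (intro mult_nonpos_nonpos) (auto intro: mult_left_mono)
  qed
  have "0 \<le> (\<integral>t. (exp (- (real j * t)) - c) * (exp (- (real k * t)) - d) \<partial>interval_measure \<phi>)"
    by (intro integral_nonneg_AE) (use * in auto)
  also have "\<dots> = (\<integral>t. exp (- (real (j + k) * t)) - c * exp (- (real k * t))
      - (d * exp (- (real j * t)) - d * c) \<partial>interval_measure \<phi>)"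
    by (intro Bochner_Integration.integral_cong)
       (auto simp: algebra_simps simp flip: exp_add)
  also have "\<dots> = laplace \<phi> (j + k) - c * laplace \<phi> k - (d * laplace \<phi> j - d * c)"
    by (simp add: laplace_def law.prob_space[simplified] del: of_nat_add)
  finally show ?thesis by (simp add: c_def)
qed simp

text \<open>Writing \<open>exp (- k s)\<close> as the integral of \<open>k exp (- k t)\<close> over \<open>t \<ge> s\<close> and exchanging the
  integrals expresses the transform through the values of the distribution function, which is
  the form in which the pointwise order can be used.\<close>

lemma laplace_eq_nn_integral:
  assumes "0 < k"
  shows "ennreal (laplace \<phi> k) =
    (\<integral>\<^sup>+t. ennreal (real k * exp (- (real k * t)) * \<phi> t) \<partial>lborel)"
proof -
  interpret pair_sigma_finite lborel "interval_measure \<phi>"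
    by (intro pair_sigma_finite.intro) (unfold_locales)
  have tail: "ennreal (exp (- (real k * s))) =
    (\<integral>\<^sup>+t. ennreal (real k * exp (- (real k * t))) * indicator {s..} t \<partial>lborel)" for s
  proof -
    have "((\<lambda>t. - exp (- (real k * t))) \<longlongrightarrow> - 0) at_top"
      using assms
      by (intro tendsto_minus filterlim_compose[OF exp_at_bot] filterlim_uminus_at_bot_at_top
          filterlim_compose[OF filterlim_uminus_at_bot_at_top]
          filterlim_tendsto_pos_mult_at_top[OF tendsto_const]) (auto intro: filterlim_ident)
    then have "(\<integral>\<^sup>+t. ennreal (real k * exp (- (real k * t))) * indicator {s..} t \<partial>lborel)
      = - 0 - (- exp (- (real k * s)))"
      by (intro nn_integral_FTC_atLeast[where F = "\<lambda>t. - exp (- (real k * t))"])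
         (auto intro!: derivative_eq_intros)
    then show ?thesis by simp
  qed
  have "ennreal (laplace \<phi> k) = (\<integral>\<^sup>+s. ennreal (exp (- (real k * s))) \<partial>interval_measure \<phi>)"
    unfolding laplace_def by (subst nn_integral_eq_integral) auto
  also have "\<dots> = (\<integral>\<^sup>+s. \<integral>\<^sup>+t. ennreal (real k * exp (- (real k * t))) * indicator {..t} s
      \<partial>lborel \<partial>interval_measure \<phi>)"
    by (subst tail) (auto intro!: nn_integral_cong split: split_indicator)
  also have "\<dots> = (\<integral>\<^sup>+t. \<integral>\<^sup>+s. ennreal (real k * exp (- (real k * t))) * indicator {..t} s
      \<partial>interval_measure \<phi> \<partial>lborel)"
    by (intro Fubini') (measurable; simp add: indicator_def)
  also have "\<dots> = (\<integral>\<^sup>+t. ennreal (real k * exp (- (real k * t)) * \<phi> t) \<partial>lborel)"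
    by (intro nn_integral_cong)
       (simp add: nn_integral_cmult emeasure_law_atMost ennreal_mult' distribution_function_range)
  finally show ?thesis .
qed

end

lemma dist_le_everywhere:
  assumes "distribution_function F" "distribution_function G" "dist_le F G"
  shows "F t \<le> G t"
  using assms by (cases "0 \<le> t") (auto simp: dist_le_def distribution_function_def)

lemma laplace_mono:
  assumes F: "distribution_function F" and G: "distribution_function G" and le: "dist_le F G"
  shows "laplace F k \<le> laplace G k"
proof (cases "k = 0")
  case True
  then show ?thesis using F G by simp
next
  case False
  then have "ennreal (laplace F k) \<le> ennreal (laplace G k)"
    using dist_le_everywhere[OF assms]
    by (simp add: laplace_eq_nn_integral F G)
       (auto intro!: nn_integral_mono ennreal_leI mult_left_mono)
  then show ?thesis using laplace_pos[OF G, of k] by (simp add: ennreal_le_iff)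
qed

text \<open>If the transforms agreed, the nonnegative difference of the integrands in
  \<open>laplace_eq_nn_integral\<close> would vanish almost everywhere, contradicting the
  inequality that right-continuity spreads from one point to an interval.\<close>

lemma laplace_strict_mono:
  assumes F: "distribution_function F" and G: "distribution_function G"
    and dom: "strictly_dominates F G" and k: "0 < k"
  shows "laplace F k < laplace G k"
proof (rule ccontr)
  have le: "dist_le F G" using dom by (simp add: strictly_dominates_def)
  have le': "F t \<le> G t" for t by (rule dist_le_everywhere[OF F G le])
  assume "\<not> laplace F k < laplace G k"
  with laplace_mono[OF F G le, of k] have eq: "laplace F k = laplace G k" by simp
  define f g where "f t = ennreal (real k * exp (- (real k * t)) * F t)"
    and "g t = ennreal (real k * exp (- (real k * t)) * G t)" for t
  have mono: "mono F" "mono G" using F G by (auto simp: distribution_function_def)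
  have [measurable]: "F \<in> borel_measurable borel" "G \<in> borel_measurable borel"
    by (intro borel_measurable_mono mono)+
  have [measurable]: "f \<in> borel_measurable lborel" "g \<in> borel_measurable lborel"
    unfolding f_def g_def by measurable
  have fg: "f t \<le> g t" for t
    unfolding f_def g_def by (intro ennreal_leI mult_left_mono le') auto
  have int: "(\<integral>\<^sup>+t. f t \<partial>lborel) = ennreal (laplace F k)" "(\<integral>\<^sup>+t. g t \<partial>lborel) = ennreal (laplace G k)"
    unfolding f_def g_def using k by (simp_all add: laplace_eq_nn_integral F G)
  have "(\<integral>\<^sup>+t. g t - f t \<partial>lborel) = 0"
    by (subst nn_integral_diff) (auto simp: int eq fg)
  then have "AE t in lborel. g t - f t = 0"
    by (subst (asm) nn_integral_0_iff_AE) auto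
  then have ae: "AE t in lborel. F t = G t"
  proof eventually_elim
    case (elim t)
    then have "g t \<le> f t" using fg[of t] by (simp add: diff_eq_0_iff_ennreal f_def)
    then have "real k * exp (- (real k * t)) * G t \<le> real k * exp (- (real k * t)) * F t"
      using distribution_function_range[OF F, of t] k
      unfolding f_def g_def by (subst (asm) ennreal_le_iff) auto
    then have "G t \<le> F t" using k by simp
    with le'[of t] show ?case by simp
  qed
  obtain t where t: "F t < G t"
    using dom le' unfolding strictly_dominates_def by (metis less_eq_real_def)
  \<comment> \<open>By right-continuity the strict inequality persists on an interval of positive length.\<close>
  have "(F \<longlongrightarrow> F t) (at_right t)" "(G \<longlongrightarrow> G t) (at_right t)"
    using F G by (auto simp: distribution_function_def continuous_within)
  then have "\<forall>\<^sub>F s in at_right t. F s < (F t + G t) / 2"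
    "\<forall>\<^sub>F s in at_right t. (F t + G t) / 2 < G s"
    using t order_tendstoD(2)[of F "F t" "at_right t" "(F t + G t) / 2"]
      order_tendstoD(1)[of G "G t" "at_right t" "(F t + G t) / 2"] by simp_all
  then have "\<forall>\<^sub>F s in at_right t. F s \<noteq> G s"
    by eventually_elim auto
  then obtain b where b: "t < b" "\<And>s. t < s \<Longrightarrow> s < b \<Longrightarrow> F s \<noteq> G s"
    by (auto simp: eventually_at_right_field)
  have "AE s in lborel. s \<notin> {t<..<b}"
    using ae by eventually_elim (use b in auto)
  moreover have "{s \<in> space lborel. \<not> s \<notin> {t<..<b}} = {t<..<b}" by auto
  ultimately have "emeasure lborel {t<..<b} = 0"
    using AE_iff_measurable[of "{t<..<b}" lborel "\<lambda>s. s \<notin> {t<..<b}"] by simp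
  with b(1) show False by simp
qed

section \<open>The annealed passage probability as a sum over paths\<close>

text \<open>A path is represented by its list of steps; the walk started at 0 follows it up to \<open>H(y)\<close>.\<close>

definition first_passage :: "int \<Rightarrow> int list set" where
  "first_passage y = {\<gamma>. set \<gamma> \<subseteq> {-1, 1} \<and> sum_list \<gamma> = y \<and>
     (\<forall>k<length \<gamma>. sum_list (take k \<gamma>) \<noteq> y)}"

text \<open>The endpoint of the path is left out, as in the exponent of \<open>e(0, y, \<omega>)\<close>.\<close>

fun visited :: "int \<Rightarrow> int list \<Rightarrow> int list" where
  "visited x [] = []"
| "visited x (s # \<gamma>) = x # visited (x + s) \<gamma>"

definition visit_weight :: "(nat \<Rightarrow> real) \<Rightarrow> int list \<Rightarrow> real" where
  "visit_weight L xs = (\<Prod>x\<in>set xs. L (count_list xs x))"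

definition passage_sum :: "(nat \<Rightarrow> real) \<Rightarrow> int \<Rightarrow> ennreal" where
  "passage_sum L y =
     (\<integral>\<^sup>+\<gamma>. ennreal ((1/2) ^ length \<gamma> * visit_weight L (visited 0 \<gamma>)) \<partial>count_space (first_passage y))"

lemma visited_conv_map: "visited x \<gamma> = map (\<lambda>j. x + sum_list (take j \<gamma>)) [0..<length \<gamma>]"
proof (induction \<gamma> arbitrary: x)
  case (Cons s \<gamma>)
  have "[0..<length (s # \<gamma>)] = 0 # map Suc [0..<length \<gamma>]"
    by (simp add: upt_conv_Cons map_Suc_upt del: upt_Suc)
  then show ?case by (simp only: list.map visited.simps Cons.IH) (simp add: o_def add.assoc)
qed simp

lemma sum_list_steps: "sum_list (map \<xi> [0..<k]) = walk 0 \<xi> k"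
  by (simp add: walk_def interv_sum_list_conv_sum_set_nat atLeast0LessThan)

lemma hitting_time_eq_enat_iff:
  "hitting_time S y = enat k \<longleftrightarrow> S k = y \<and> (\<forall>j<k. S j \<noteq> y)"
proof
  assume H: "hitting_time S y = enat k"
  then have ne: "{enat k |k. S k = y} \<noteq> {}"
    by (auto simp: hitting_time_def Inf_enat_def split: if_splits)
  then have "hitting_time S y \<in> {enat k |k. S k = y}"
    unfolding hitting_time_def Inf_enat_def by (auto intro: LeastI)
  then have "S k = y" using H by auto
  moreover have "S j \<noteq> y" if "j < k" for j
  proof
    assume "S j = y"
    then have "hitting_time S y \<le> enat j"
      unfolding hitting_time_def by (intro Inf_lower) auto
    with that H show False by simp
  qed
  ultimately show "S k = y \<and> (\<forall>j<k. S j \<noteq> y)" by blast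
next
  assume *: "S k = y \<and> (\<forall>j<k. S j \<noteq> y)"
  show "hitting_time S y = enat k"
    unfolding hitting_time_def
  proof (rule antisym)
    show "Inf {enat k |k. S k = y} \<le> enat k"
      by (rule Inf_lower) (use * in auto)
    show "enat k \<le> Inf {enat k |k. S k = y}"
      by (rule Inf_greatest) (use * in \<open>auto simp: not_less[symmetric]\<close>)
  qed
qed

text \<open>At most one path in the sum is a prefix of \<open>\<xi>\<close>, namely the one leading to \<open>H(y)\<close>. The steps
  of \<open>\<xi>\<close> are arbitrary integers here, so that the identity holds at every point of the sample
  space and yields measurability; other steps than \<open>\<pm>1\<close> have probability 0.\<close>

lemma hit_indicator_eq_path_sum:
  fixes \<omega> :: "int \<Rightarrow> real"
  defines "w \<equiv> \<lambda>\<gamma>. ennreal (exp (- sum_list (map \<omega> (visited 0 \<gamma>))))"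
  shows "ennreal (let S = walk 0 \<xi>; H = hitting_time S y in
            if H < \<infinity> then exp (- (\<Sum>k<the_enat H. \<omega> (S k))) else 0) =
    (\<integral>\<^sup>+\<gamma>. (if map \<xi> [0..<length \<gamma>] = \<gamma> then w \<gamma> else 0)
       \<partial>count_space {\<gamma>. sum_list \<gamma> = y \<and> (\<forall>k<length \<gamma>. sum_list (take k \<gamma>) \<noteq> y)})"
    (is "ennreal ?f = (\<integral>\<^sup>+\<gamma>. ?g \<gamma> \<partial>count_space ?Q)")
proof -
  have prefix: "\<gamma> \<in> ?Q \<longleftrightarrow> hitting_time (walk 0 \<xi>) y = enat (length \<gamma>)"
    if "map \<xi> [0..<length \<gamma>] = \<gamma>" for \<gamma>
  proof -
    have "sum_list (take k \<gamma>) = walk 0 \<xi> k" if "k \<le> length \<gamma>" for k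
      using \<open>map \<xi> [0..<length \<gamma>] = \<gamma>\<close> that
      by (metis add_0 le_add_same_cancel1 sum_list_steps take_map take_upt zero_le)
    from this[of "length \<gamma>"] this show ?thesis
      by (auto simp: hitting_time_eq_enat_iff)
  qed
  show ?thesis
  proof (cases "hitting_time (walk 0 \<xi>) y")
    case (enat k)
    define \<gamma> where "\<gamma> = map \<xi> [0..<k]"
    have \<gamma>: "map \<xi> [0..<length \<gamma>] = \<gamma>" "length \<gamma> = k" by (simp_all add: \<gamma>_def)
    then have Q: "\<gamma> \<in> ?Q" using prefix[OF \<gamma>(1)] enat by simp
    have "(\<integral>\<^sup>+\<gamma>. ?g \<gamma> \<partial>count_space ?Q) = (\<Sum>\<gamma>\<in>{\<gamma>}. ?g \<gamma>)"
    proof (rule nn_integral_count_space')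
      fix \<gamma>' assume *: "\<gamma>' \<in> ?Q" "\<gamma>' \<notin> {\<gamma>}"
      have "map \<xi> [0..<length \<gamma>'] \<noteq> \<gamma>'"
      proof
        assume eq: "map \<xi> [0..<length \<gamma>'] = \<gamma>'"
        have "length \<gamma>' = k" using prefix[OF eq] * enat by simp
        with eq have "map \<xi> [0..<k] = \<gamma>'" by simp
        with * show False by (simp add: \<gamma>_def)
      qed
      then show "?g \<gamma>' = 0" by simp
    qed (use Q in auto)
    also have "\<dots> = w \<gamma>" using \<gamma>(1) by simp
    also have "visited 0 \<gamma> = map (walk 0 \<xi>) [0..<k]"
      unfolding visited_conv_map \<gamma>_def
      by (auto simp: take_map take_upt sum_list_steps)
    then have "w \<gamma> = ennreal (exp (- (\<Sum>j<k. \<omega> (walk 0 \<xi> j))))"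
      by (simp add: w_def interv_sum_list_conv_sum_set_nat atLeast0LessThan)
    finally have *: "(\<integral>\<^sup>+\<gamma>. ?g \<gamma> \<partial>count_space ?Q) = ennreal (exp (- (\<Sum>j<k. \<omega> (walk 0 \<xi> j))))" .
    have "?f = exp (- (\<Sum>j<k. \<omega> (walk 0 \<xi> j)))" using enat by simp
    then show ?thesis by (simp only: *)
  next
    case infinity
    have zero: "?g \<gamma> = 0" if "\<gamma> \<in> ?Q" for \<gamma>
      using prefix[of \<gamma>] that infinity by auto
    have "(\<integral>\<^sup>+\<gamma>. ?g \<gamma> \<partial>count_space ?Q) = (\<integral>\<^sup>+\<gamma>. 0 \<partial>count_space ?Q)"
      by (intro nn_integral_cong zero) (simp only: space_count_space)
    also have "\<dots> = 0" by simp
    finally have *: "(\<integral>\<^sup>+\<gamma>. ?g \<gamma> \<partial>count_space ?Q) = 0" .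
    have "?f = 0" using infinity by simp
    then have "ennreal ?f = 0" by (simp only: ennreal_0)
    then show ?thesis by (rule trans[OF _ *[symmetric]])
  qed
qed

lemma emeasure_step_measure_prefix:
  "{\<xi>. map \<xi> [0..<length \<gamma>] = \<gamma>} \<in> sets step_measure" (is "?C \<in> _")
  "emeasure step_measure {\<xi>. map \<xi> [0..<length \<gamma>] = \<gamma>} =
     (if set \<gamma> \<subseteq> {-1, 1} then ennreal ((1/2) ^ length \<gamma>) else 0)"
proof -
  interpret product_prob_space "\<lambda>_::nat. measure_pmf (pmf_of_set {-1, 1 :: int})" UNIV
    by unfold_locales
  have space: "space step_measure = UNIV"
    by (simp add: step_measure_def space_PiM)
  have eq: "?C = {\<xi>\<in>space step_measure. \<forall>i\<in>{..<length \<gamma>}. \<xi> i \<in> {\<gamma> ! i}}"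
    unfolding space by (subst list_eq_iff_nth_eq) auto
  show "?C \<in> sets step_measure"
    unfolding eq unfolding step_measure_def
  proof (rule sets.sets_Collect_finite_All)
    fix i
    show "{\<xi> \<in> space (Pi\<^sub>M UNIV (\<lambda>_. measure_pmf (pmf_of_set {-1, 1}))). \<xi> i \<in> {\<gamma> ! i}}
        \<in> sets (Pi\<^sub>M UNIV (\<lambda>_. measure_pmf (pmf_of_set {-1, 1})))"
      by (rule sets_Collect_single) simp_all
  qed simp
  have "emeasure step_measure ?C =
      (\<Prod>i<length \<gamma>. emeasure (measure_pmf (pmf_of_set {-1, 1})) {\<gamma> ! i})"
    unfolding eq unfolding step_measure_def
    by (rule emeasure_PiM_Collect) auto
  also have "\<dots> = (\<Prod>i<length \<gamma>. if \<gamma> ! i \<in> {-1, 1} then ennreal (1/2) else 0)"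
    by (intro prod.cong) (auto simp: emeasure_pmf_single indicator_def)
  also have "\<dots> = (if set \<gamma> \<subseteq> {-1, 1} then ennreal ((1/2) ^ length \<gamma>) else 0)"
  proof (cases "set \<gamma> \<subseteq> {-1, 1}")
    case True
    then have "\<gamma> ! i \<in> {-1, 1}" if "i < length \<gamma>" for i using that nth_mem by blast
    then have "(\<Prod>i<length \<gamma>. if \<gamma> ! i \<in> {-1, 1} then ennreal (1/2) else 0)
        = (\<Prod>i<length \<gamma>. ennreal (1/2))" by (intro prod.cong) auto
    also have "\<dots> = ennreal ((1/2) ^ length \<gamma>)"
      by (subst prod_constant) (subst ennreal_power, auto)
    finally show ?thesis using True by simp
  next
    case False
    then obtain i where "i < length \<gamma>" "\<gamma> ! i \<notin> {-1, 1}" by (metis in_set_conv_nth subsetI)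
    then show ?thesis using False by (auto simp: intro!: prod_zero)
  qed
  finally show "emeasure step_measure ?C = \<dots>" .
qed

lemma borel_measurable_nn_integral_countable:
  fixes f :: "'i \<Rightarrow> 'a \<Rightarrow> ennreal"
  assumes I: "countable I" and [measurable]: "\<And>i. i \<in> I \<Longrightarrow> f i \<in> borel_measurable M"
  shows "(\<lambda>x. \<integral>\<^sup>+i. f i x \<partial>count_space I) \<in> borel_measurable M"
proof (cases "finite I")
  case True
  then show ?thesis by (simp add: nn_integral_count_space_finite)
next
  case False
  then have "bij_betw (from_nat_into I) UNIV I" using I by (rule bij_betw_from_nat_into[rotated])
  moreover from this have "from_nat_into I n \<in> I" for n by (auto simp: bij_betw_def)
  ultimately show ?thesis
    by (subst nn_integral_bij_count_space[symmetric]) (auto simp: nn_integral_count_space_nat)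
qed

text \<open>Only countably many paths compete, so the expectation over the walk may be taken path by path.\<close>

lemma
  fixes \<omega> :: "int \<Rightarrow> real"
  defines "f \<equiv> \<lambda>y \<xi>. let S = walk 0 \<xi>; H = hitting_time S y in
            if H < \<infinity> then exp (- (\<Sum>k<the_enat H. \<omega> (S k))) else 0"
  shows borel_measurable_hit: "f y \<in> borel_measurable step_measure"
    and nn_integral_hit: "(\<integral>\<^sup>+\<xi>. ennreal (f y \<xi>) \<partial>step_measure) =
      (\<integral>\<^sup>+\<gamma>. ennreal ((1/2) ^ length \<gamma>) *
        ennreal (exp (- sum_list (map \<omega> (visited 0 \<gamma>)))) \<partial>count_space (first_passage y))"
proof -
  define w where "w \<gamma> = ennreal (exp (- sum_list (map \<omega> (visited 0 \<gamma>))))" for \<gamma>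
  define Q where "Q = {\<gamma>. sum_list \<gamma> = y \<and> (\<forall>k<length \<gamma>. sum_list (take k \<gamma>) \<noteq> y)}"
  define g where "g \<gamma> \<xi> = w \<gamma> * indicator {\<xi>. map \<xi> [0..<length \<gamma>] = \<gamma>} \<xi>" for \<gamma> \<xi>
  note [measurable] = emeasure_step_measure_prefix(1)
  have g_meas[measurable]: "g \<gamma> \<in> borel_measurable step_measure" for \<gamma>
    unfolding g_def by measurable
  have f: "ennreal (f y \<xi>) = (\<integral>\<^sup>+\<gamma>. g \<gamma> \<xi> \<partial>count_space Q)" for \<xi>
    unfolding f_def hit_indicator_eq_path_sum Q_def g_def w_def
    by (intro nn_integral_cong) auto
  have nonneg: "0 \<le> f y \<xi>" for \<xi> by (simp add: f_def Let_def)
  have "(\<lambda>\<xi>. \<integral>\<^sup>+\<gamma>. g \<gamma> \<xi> \<partial>count_space Q) \<in> borel_measurable step_measure"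
    by (intro borel_measurable_nn_integral_countable) (auto simp: g_meas)
  then have "(\<lambda>\<xi>. enn2real (\<integral>\<^sup>+\<gamma>. g \<gamma> \<xi> \<partial>count_space Q)) \<in> borel_measurable step_measure"
    by measurable
  then show "f y \<in> borel_measurable step_measure"
    using nonneg by (simp add: f[symmetric])
  have "(\<integral>\<^sup>+\<xi>. ennreal (f y \<xi>) \<partial>step_measure) =
      (\<integral>\<^sup>+\<gamma>. \<integral>\<^sup>+\<xi>. g \<gamma> \<xi> \<partial>step_measure \<partial>count_space Q)"
    unfolding f by (intro nn_integral_count_space_nn_integral) (auto simp: g_meas)
  also have "\<dots> = (\<integral>\<^sup>+\<gamma>. w \<gamma> * (if set \<gamma> \<subseteq> {-1, 1} then ennreal ((1/2) ^ length \<gamma>) else 0)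
      \<partial>count_space Q)"
    by (intro nn_integral_cong)
       (simp add: g_def nn_integral_cmult_indicator emeasure_step_measure_prefix)
  also have "\<dots> = (\<integral>\<^sup>+\<gamma>. w \<gamma> * (if set \<gamma> \<subseteq> {-1, 1} then ennreal ((1/2) ^ length \<gamma>) else 0)
      \<partial>count_space (first_passage y))"
    by (rule nn_integral_count_space_eq) (auto simp: Q_def first_passage_def)
  also have "\<dots> = (\<integral>\<^sup>+\<gamma>. ennreal ((1/2) ^ length \<gamma>) * w \<gamma> \<partial>count_space (first_passage y))"
    by (intro nn_integral_cong) (auto simp: first_passage_def mult.commute)
  finally show "(\<integral>\<^sup>+\<xi>. ennreal (f y \<xi>) \<partial>step_measure) =
      (\<integral>\<^sup>+\<gamma>. ennreal ((1/2) ^ length \<gamma>) *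
        ennreal (exp (- sum_list (map \<omega> (visited 0 \<gamma>)))) \<partial>count_space (first_passage y))"
    by (simp add: w_def)
qed

lemma e_hit_eq_path_sum:
  "e_hit 0 y \<omega> = enn2real (\<integral>\<^sup>+\<gamma>. ennreal ((1/2) ^ length \<gamma>) *
      ennreal (exp (- sum_list (map \<omega> (visited 0 \<gamma>)))) \<partial>count_space (first_passage y))"
  unfolding e_hit_def nn_integral_hit[symmetric]
  by (intro integral_eq_nn_integral borel_measurable_hit) (auto simp: Let_def)

text \<open>For the zero potential the sum over paths is the probability of ever hitting \<open>y\<close>.\<close>

lemma first_passage_weight_le_1:
  "(\<integral>\<^sup>+\<gamma>. ennreal ((1/2) ^ length \<gamma>) \<partial>count_space (first_passage y)) \<le> 1"
proof -
  interpret prob_space step_measure by (rule prob_space_step_measure)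
  have "(\<integral>\<^sup>+\<gamma>. ennreal ((1/2) ^ length \<gamma>) \<partial>count_space (first_passage y)) =
    (\<integral>\<^sup>+\<gamma>. ennreal ((1/2) ^ length \<gamma>) * ennreal (exp (- sum_list (map (\<lambda>_. 0) (visited 0 \<gamma>))))
       \<partial>count_space (first_passage y))"
    by simp
  also have "\<dots> \<le> (\<integral>\<^sup>+\<xi>. 1 \<partial>step_measure)"
    unfolding nn_integral_hit[symmetric]
    by (intro nn_integral_mono) (auto simp: Let_def)
  also have "\<dots> = 1" by (simp add: emeasure_space_1)
  finally show ?thesis .
qed

text \<open>Collecting the visits to each site and using independence of the potential across sites
  averages each site separately, with its number of visits as the argument of the transform.\<close>

lemma integral_exp_path:
  assumes "distribution_function \<phi>"
  shows "(\<integral>\<^sup>+\<omega>. ennreal (exp (- sum_list (map \<omega> xs))) \<partial>potential_measure \<phi>) =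
    ennreal (visit_weight (laplace \<phi>) xs)"
proof -
  interpret law: prob_space "interval_measure \<phi>" by (rule prob_space_law[OF assms])
  interpret product_prob_space "\<lambda>_::int. interval_measure \<phi>" UNIV by unfold_locales
  define h where "h x t = ennreal (exp (- (real (count_list xs x) * t)))" for x and t :: real
  have [measurable]: "h x \<in> borel_measurable (interval_measure \<phi>)" for x
    unfolding h_def by measurable
  have "exp (- sum_list (map \<omega> xs)) = (\<Prod>x\<in>set xs. exp (- (real (count_list xs x) * \<omega> x)))"
    for \<omega> :: "int \<Rightarrow> real"
  proof -
    have "sum_list (map \<omega> xs) = (\<Sum>x\<in>set xs. real (count_list xs x) * \<omega> x)"
    proof (induction xs)
      case (Cons a xs)
      have "(\<Sum>x\<in>set (a # xs). real (count_list (a # xs) x) * \<omega> x) =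
        (\<Sum>x\<in>set (a # xs). real (count_list xs x) * \<omega> x + (if x = a then \<omega> a else 0))"
        by (intro sum.cong) (auto simp: algebra_simps)
      also have "\<dots> = (\<Sum>x\<in>set (a # xs). real (count_list xs x) * \<omega> x) + \<omega> a"
        by (simp add: sum.distrib)
      also have "(\<Sum>x\<in>set (a # xs). real (count_list xs x) * \<omega> x) =
          (\<Sum>x\<in>set xs. real (count_list xs x) * \<omega> x)"
        by (rule sum.mono_neutral_right) auto
      finally show ?case using Cons.IH by simp
    qed simp
    then show ?thesis by (simp add: exp_sum sum_negf[symmetric])
  qed
  then have eq: "ennreal (exp (- sum_list (map \<omega> xs))) = (\<Prod>x\<in>set xs. h x (restrict \<omega> (set xs) x))"
    for \<omega> :: "int \<Rightarrow> real"
    unfolding h_def by (subst prod_ennreal) auto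
  have "(\<integral>\<^sup>+\<omega>. ennreal (exp (- sum_list (map \<omega> xs))) \<partial>potential_measure \<phi>) =
     (\<integral>\<^sup>+\<omega>. (\<Prod>x\<in>set xs. h x (\<omega> x)) \<partial>distr (potential_measure \<phi>)
        (Pi\<^sub>M (set xs) (\<lambda>_. interval_measure \<phi>)) (\<lambda>\<omega>. restrict \<omega> (set xs)))"
    unfolding eq potential_measure_def
    by (subst nn_integral_distr[OF measurable_restrict_subset]) auto
  also have "\<dots> = (\<integral>\<^sup>+\<omega>. (\<Prod>x\<in>set xs. h x (\<omega> x)) \<partial>Pi\<^sub>M (set xs) (\<lambda>_. interval_measure \<phi>))"
    unfolding potential_measure_def by (subst distr_PiM_restrict_finite) auto
  also have "\<dots> = (\<Prod>x\<in>set xs. \<integral>\<^sup>+t. h x t \<partial>interval_measure \<phi>)"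
    by (rule product_nn_integral_prod) auto
  also have "\<dots> = (\<Prod>x\<in>set xs. ennreal (laplace \<phi> (count_list xs x)))"
    unfolding h_def laplace_def
    by (intro prod.cong refl) (subst nn_integral_eq_integral, auto simp: integrable_exp_law assms)
  also have "\<dots> = ennreal (visit_weight (laplace \<phi>) xs)"
    unfolding visit_weight_def by (rule prod_ennreal) (simp add: laplace_pos[OF assms] less_imp_le)
  finally show ?thesis .
qed

lemma visit_weight_nonneg: "(\<And>k. 0 \<le> L k) \<Longrightarrow> 0 \<le> visit_weight L xs"
  unfolding visit_weight_def by (simp add: prod_nonneg)

lemma visit_weight_le_1: "(\<And>k. 0 \<le> L k) \<Longrightarrow> (\<And>k. L k \<le> 1) \<Longrightarrow> visit_weight L xs \<le> 1"
  unfolding visit_weight_def by (intro prod_le_1) auto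

lemma passage_sum_le_1:
  assumes "\<And>k. 0 \<le> L k" "\<And>k. L k \<le> 1"
  shows "passage_sum L y \<le> 1"
proof -
  have "passage_sum L y \<le> (\<integral>\<^sup>+\<gamma>. ennreal ((1/2) ^ length \<gamma>) \<partial>count_space (first_passage y))"
    unfolding passage_sum_def
    using visit_weight_le_1[of L] assms
    by (intro nn_integral_mono ennreal_leI) (simp add: mult_le_cancel_left1)
  also note first_passage_weight_le_1
  finally show ?thesis .
qed

text \<open>The quenched quantity is a countable sum over paths, and the potential is averaged term by
  term. For potentials with negative values the sum over paths may be infinite, but its
  mean is at most 1, so this happens only with probability 0.\<close>

lemma annealed_cost_eq:
  assumes \<phi>: "distribution_function \<phi>"
  shows "annealed_cost \<phi> 0 y = - ln (enn2real (passage_sum (laplace \<phi>) y))"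
proof -
  define E where "E \<omega> = (\<integral>\<^sup>+\<gamma>. ennreal ((1/2) ^ length \<gamma>) *
      ennreal (exp (- sum_list (map \<omega> (visited 0 \<gamma>)))) \<partial>count_space (first_passage y))" for \<omega>
  have path_meas[measurable]: "(\<lambda>\<omega>. ennreal (exp (- sum_list (map \<omega> xs)))) \<in> borel_measurable (potential_measure \<phi>)" for xs
  proof (induction xs)
    case (Cons a xs)
    have "(\<lambda>\<omega>. \<omega> a) \<in> borel_measurable (potential_measure \<phi>)"
      unfolding potential_measure_def by measurable
    with Cons show ?case
      by (simp add: exp_add exp_diff exp_minus ennreal_mult divide_inverse)
  qed simp
  have E_meas[measurable]: "E \<in> borel_measurable (potential_measure \<phi>)"
    unfolding E_def by (intro borel_measurable_nn_integral_countable) auto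
  have int: "(\<integral>\<^sup>+\<omega>. E \<omega> \<partial>potential_measure \<phi>) = passage_sum (laplace \<phi>) y"
  proof -
    have "(\<integral>\<^sup>+\<omega>. E \<omega> \<partial>potential_measure \<phi>) = (\<integral>\<^sup>+\<gamma>. \<integral>\<^sup>+\<omega>. ennreal ((1/2) ^ length \<gamma>) *
      ennreal (exp (- sum_list (map \<omega> (visited 0 \<gamma>)))) \<partial>potential_measure \<phi> \<partial>count_space (first_passage y))"
      unfolding E_def by (intro nn_integral_count_space_nn_integral) auto
    also have "\<dots> = passage_sum (laplace \<phi>) y"
      unfolding passage_sum_def
      by (intro nn_integral_cong)
         (simp add: nn_integral_cmult[OF path_meas] integral_exp_path[OF \<phi>] ennreal_mult'
           visit_weight_nonneg laplace_pos[OF \<phi>] less_imp_le)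
    finally show ?thesis .
  qed
  have "passage_sum (laplace \<phi>) y \<le> 1"
    by (intro passage_sum_le_1) (auto simp: laplace_pos laplace_le_1 \<phi> less_imp_le)
  then have "(\<integral>\<^sup>+\<omega>. E \<omega> \<partial>potential_measure \<phi>) \<noteq> \<infinity>"
    unfolding int by (auto simp: top_unique)
  then have "AE \<omega> in potential_measure \<phi>. E \<omega> \<noteq> \<infinity>"
    by (intro nn_integral_PInf_AE) auto
  then have "(\<integral>\<^sup>+\<omega>. ennreal (enn2real (E \<omega>)) \<partial>potential_measure \<phi>) = (\<integral>\<^sup>+\<omega>. E \<omega> \<partial>potential_measure \<phi>)"
    by (intro nn_integral_cong_AE) (auto elim!: eventually_mono simp: less_top)
  moreover have "(\<integral>\<omega>. e_hit 0 y \<omega> \<partial>potential_measure \<phi>) =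
      enn2real (\<integral>\<^sup>+\<omega>. ennreal (enn2real (E \<omega>)) \<partial>potential_measure \<phi>)"
    unfolding e_hit_eq_path_sum E_def[symmetric]
    by (intro integral_eq_nn_integral) auto
  ultimately show ?thesis unfolding annealed_cost_def int by simp
qed

section \<open>Superadditivity and existence of the exponent\<close>

lemma fekete:
  fixes b :: "nat \<Rightarrow> real"
  assumes nonneg: "\<And>n. 0 \<le> b n" and sub: "\<And>m n. b (m + n) \<le> b m + b n"
  shows "(\<lambda>n. b n / real n) \<longlonglongrightarrow> (INF n\<in>{1..}. b n / real n)" (is "_ \<longlonglongrightarrow> ?I")
    and "0 < n \<Longrightarrow> (INF n\<in>{1..}. b n / real n) \<le> b n / real n"
proof -
  have bdd: "bdd_below ((\<lambda>n. b n / real n) ` {1..})"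
    by (rule bdd_belowI2[where m = 0]) (simp add: nonneg)
  show lower: "?I \<le> b n / real n" if "0 < n" for n
    using bdd by (rule cINF_lower) (use that in simp)
  have mult: "b (q * m + r) \<le> real q * b m + b r" for q m r
  proof (induction q)
    case (Suc q)
    have "b (Suc q * m + r) \<le> b m + b (q * m + r)"
      using sub[of m "q * m + r"] by (simp add: add.assoc)
    with Suc show ?case by (simp add: algebra_simps)
  qed simp
  show "(\<lambda>n. b n / real n) \<longlonglongrightarrow> ?I"
  proof (rule LIMSEQ_I)
    fix \<epsilon> :: real assume \<epsilon>: "0 < \<epsilon>"
    then have "?I < ?I + \<epsilon> / 2" by simp
    then obtain m where m: "1 \<le> m" "b m / real m < ?I + \<epsilon> / 2"
      using bdd by (subst (asm) cINF_less_iff) auto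
    \<comment> \<open>A bound for \<open>b r\<close> over all remainders \<open>r < m\<close>.\<close>
    define C where "C = real m * b 1 + b 0"
    have rest: "b r \<le> C" if "r < m" for r
    proof -
      have "b r \<le> real r * b 1 + b 0" using mult[of r 1 0] by simp
      also have "\<dots> \<le> C"
        unfolding C_def using that by (intro add_right_mono mult_right_mono nonneg) auto
      finally show ?thesis .
    qed
    obtain N :: nat where N: "2 * C / \<epsilon> < real N" using reals_Archimedean2 by blast
    show "\<exists>no. \<forall>n\<ge>no. norm (b n / real n - ?I) < \<epsilon>"
    proof (intro exI allI impI)
      fix n assume n: "max 1 N \<le> n"
      then have n0: "0 < n" by simp
      have "b n \<le> real (n div m) * b m + b (n mod m)"
        using mult[of "n div m" m "n mod m"] by simp
      also have "\<dots> \<le> real n / real m * b m + C"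
        using m(1) by (intro add_mono mult_right_mono nonneg rest of_nat_div_le_of_nat) auto
      finally have "b n / real n \<le> (real n / real m * b m + C) / real n"
        by (rule divide_right_mono) simp
      also have "\<dots> = b m / real m + C / real n"
        using n0 m(1) by (simp add: field_simps)
      also have "C / real n < \<epsilon> / 2"
      proof -
        have "2 * C / \<epsilon> < real n" using N n by linarith
        then show ?thesis using \<epsilon> n0 by (simp add: field_simps)
      qed
      finally have "b n / real n < ?I + \<epsilon>" using m(2) by linarith
      with lower[OF n0] show "norm (b n / real n - ?I) < \<epsilon>" by simp
    qed
  qed
qed

text \<open>Steps of size one cannot jump over the target.\<close>

lemma first_passage_below:
  assumes \<gamma>: "\<gamma> \<in> first_passage y" and y: "0 \<le> y" and k: "k < length \<gamma>"
  shows "sum_list (take k \<gamma>) < y"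
  using k
proof (induction k)
  case 0
  then have "sum_list (take 0 \<gamma>) \<noteq> y" using \<gamma> unfolding first_passage_def by blast
  then show ?case using y by simp
next
  case (Suc k)
  have "\<gamma> ! k \<in> {-1, 1}" using \<gamma> nth_mem[OF Suc_lessD[OF Suc.prems]] unfolding first_passage_def by blast
  then have "sum_list (take (Suc k) \<gamma>) \<le> sum_list (take k \<gamma>) + 1"
    using Suc.prems by (auto simp: take_Suc_conv_app_nth)
  also have "\<dots> \<le> y" using Suc by simp
  finally show ?case
    using \<gamma> Suc.prems by (force simp: first_passage_def)
qed

lemma first_passage_append:
  assumes "\<gamma> \<in> first_passage (int m)" "\<gamma>' \<in> first_passage (int n)"
  shows "\<gamma> @ \<gamma>' \<in> first_passage (int (m + n))"
proof -
  have "sum_list (take k (\<gamma> @ \<gamma>')) \<noteq> int (m + n)" if "k < length (\<gamma> @ \<gamma>')" for k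
  proof (cases "k < length \<gamma>")
    case True
    with first_passage_below[OF assms(1) _ True] show ?thesis by simp
  next
    case False
    with that have "k - length \<gamma> < length \<gamma>'" by simp
    with assms False show ?thesis by (auto simp: first_passage_def)
  qed
  then show ?thesis using assms by (auto simp: first_passage_def)
qed

lemma first_passage_prefix_unique:
  assumes "\<gamma> \<in> first_passage y" "\<delta> \<in> first_passage y" "\<gamma> @ \<gamma>' = \<delta> @ \<delta>'"
  shows "\<gamma> = \<delta> \<and> \<gamma>' = \<delta>'"
proof -
  have *: "\<not> length \<alpha> < length \<beta>"
    if "\<alpha> \<in> first_passage y" "\<beta> \<in> first_passage y" "\<alpha> @ \<alpha>' = \<beta> @ \<beta>'" for \<alpha> \<beta> \<alpha>' \<beta>'
  proof
    assume less: "length \<alpha> < length \<beta>"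
    from that(3) have "take (length \<alpha>) (\<alpha> @ \<alpha>') = take (length \<alpha>) (\<beta> @ \<beta>')"
      by (rule arg_cong)
    with less have "take (length \<alpha>) \<beta> = \<alpha>" by simp
    moreover have "sum_list (take (length \<alpha>) \<beta>) \<noteq> y" "sum_list \<alpha> = y"
      using that(1,2) less unfolding first_passage_def by blast+
    ultimately show False by simp
  qed
  have "length \<gamma> = length \<delta>" using *[OF assms] *[OF assms(2,1) assms(3)[symmetric]] by simp
  then show ?thesis using assms(3) by simp
qed

lemma visited_append: "visited x (\<gamma> @ \<gamma>') = visited x \<gamma> @ visited (x + sum_list \<gamma>) \<gamma>'"
  by (induction \<gamma> arbitrary: x) (simp_all add: add.assoc)

lemma visited_shift: "visited (x + c) \<gamma> = map (\<lambda>z. z + c) (visited x \<gamma>)"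
proof (induction \<gamma> arbitrary: x)
  case (Cons s \<gamma>)
  then show ?case using Cons.IH[of "x + s"] by (simp add: add.assoc add.commute[of c s])
qed simp

lemma visit_weight_shift: "visit_weight L (map (\<lambda>z. z + c) xs) = visit_weight L xs"
  unfolding visit_weight_def
  by (subst set_map, subst prod.reindex)
     (auto simp: inj_on_def count_list_map_conv[of "\<lambda>z. z + c" xs] intro!: prod.cong)

lemma visit_weight_append:
  assumes "\<And>k. 0 \<le> L k" "L 0 = 1" "\<And>j k. L j * L k \<le> L (j + k)"
  shows "visit_weight L xs * visit_weight L ys \<le> visit_weight L (xs @ ys)"
proof -
  let ?V = "set xs \<union> set ys"
  have "visit_weight L xs = (\<Prod>x\<in>?V. L (count_list xs x))"
    "visit_weight L ys = (\<Prod>x\<in>?V. L (count_list ys x))"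
    unfolding visit_weight_def by (intro prod.mono_neutral_left; auto simp: assms)+
  then have "visit_weight L xs * visit_weight L ys =
      (\<Prod>x\<in>?V. L (count_list xs x) * L (count_list ys x))"
    by (simp add: prod.distrib)
  also have "\<dots> \<le> (\<Prod>x\<in>?V. L (count_list xs x + count_list ys x))"
    by (intro prod_mono) (simp add: assms)
  also have "\<dots> = visit_weight L (xs @ ys)"
    by (simp add: visit_weight_def)
  finally show ?thesis .
qed

text \<open>Concatenating a first passage to \<open>m\<close> with a first passage by a further \<open>n\<close> is an injective
  operation into the first passages to \<open>m + n\<close>, and by positive association a site used by both
  parts contributes at least the product of its two separate contributions.\<close>

lemma passage_sum_supermultiplicative:
  assumes L: "\<And>k. 0 \<le> L k" "L 0 = 1" "\<And>j k. L j * L k \<le> L (j + k)"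
  shows "passage_sum L (int m) * passage_sum L (int n) \<le> passage_sum L (int (m + n))"
proof -
  define f where "f \<gamma> = ennreal ((1/2) ^ length \<gamma> * visit_weight L (visited 0 \<gamma>))" for \<gamma>
  define A where "A = first_passage (int m) \<times> first_passage (int n)"
  define B where "B = (\<lambda>p. fst p @ snd p) ` A"
  have f_append: "f \<gamma> * f \<gamma>' \<le> f (\<gamma> @ \<gamma>')" for \<gamma> \<gamma>'
  proof -
    have "visit_weight L (visited 0 \<gamma>) * visit_weight L (visited 0 \<gamma>') \<le>
        visit_weight L (visited 0 (\<gamma> @ \<gamma>'))"
      using visit_weight_append[OF L, of "visited 0 \<gamma>" "visited (sum_list \<gamma>) \<gamma>'"]
        visited_shift[of 0 "sum_list \<gamma>" \<gamma>']
      by (simp add: visited_append visit_weight_shift)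
    then have "(1/2) ^ length (\<gamma> @ \<gamma>') *
        (visit_weight L (visited 0 \<gamma>) * visit_weight L (visited 0 \<gamma>')) \<le>
        (1/2) ^ length (\<gamma> @ \<gamma>') * visit_weight L (visited 0 (\<gamma> @ \<gamma>'))"
      by (intro mult_left_mono) auto
    then show ?thesis
      unfolding f_def using L(1)
      by (subst ennreal_mult[symmetric])
         (auto simp: visit_weight_nonneg power_add ac_simps intro!: ennreal_leI)
  qed
  have "passage_sum L (int m) * passage_sum L (int n) =
      (\<integral>\<^sup>+\<gamma>. (\<integral>\<^sup>+\<gamma>'. (f \<gamma> * indicator (first_passage (int m)) \<gamma>) *
        (f \<gamma>' * indicator (first_passage (int n)) \<gamma>') \<partial>count_space UNIV) \<partial>count_space UNIV)"
    unfolding passage_sum_def f_def[symmetric]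
    by (simp add: nn_integral_count_space_indicator nn_integral_cmult nn_integral_multc)
  also have "\<dots> = (\<integral>\<^sup>+(\<gamma>, \<gamma>'). (f \<gamma> * indicator (first_passage (int m)) \<gamma>) *
        (f \<gamma>' * indicator (first_passage (int n)) \<gamma>') \<partial>count_space UNIV)"
    by (subst nn_integral_fst_count_space[symmetric]) simp
  also have "\<dots> \<le> (\<integral>\<^sup>+p. f (fst p @ snd p) * indicator A p \<partial>count_space UNIV)"
    by (intro nn_integral_mono) (auto simp: A_def f_append indicator_def)
  also have "\<dots> = (\<integral>\<^sup>+p. f (fst p @ snd p) \<partial>count_space A)"
    by (simp add: nn_integral_count_space_indicator A_def)
  also have "\<dots> = (\<integral>\<^sup>+\<gamma>. f \<gamma> \<partial>count_space B)"
  proof (rule nn_integral_bij_count_space)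
    show "bij_betw (\<lambda>p. fst p @ snd p) A B"
      unfolding A_def B_def
      by (intro inj_on_imp_bij_betw) (auto simp: inj_on_def dest: first_passage_prefix_unique)
  qed
  also have "\<dots> = (\<integral>\<^sup>+\<gamma>. f \<gamma> * indicator B \<gamma> \<partial>count_space B)"
    by (intro nn_integral_cong) simp
  also have "\<dots> = (\<integral>\<^sup>+\<gamma>. f \<gamma> * indicator B \<gamma> \<partial>count_space (first_passage (int (m + n))))"
    by (rule nn_integral_count_space_eq)
       (auto simp: B_def A_def first_passage_append simp del: of_nat_add)
  also have "\<dots> \<le> (\<integral>\<^sup>+\<gamma>. f \<gamma> \<partial>count_space (first_passage (int (m + n))))"
    by (intro nn_integral_mono) (simp add: indicator_def)
  finally show ?thesis by (simp only: passage_sum_def f_def)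
qed

text \<open>The annealed mean of \<open>e(0, n, \<omega>)\<close>, as the proof of \<open>annealed_cost_eq\<close> shows.\<close>

definition passage_prob :: "(real \<Rightarrow> real) \<Rightarrow> nat \<Rightarrow> real" where
  "passage_prob \<phi> n = enn2real (passage_sum (laplace \<phi>) (int n))"

context
  fixes \<phi> :: "real \<Rightarrow> real"
  assumes df: "distribution_function \<phi>"
begin

lemma ennreal_passage_prob: "ennreal (passage_prob \<phi> n) = passage_sum (laplace \<phi>) (int n)"
proof -
  have "passage_sum (laplace \<phi>) (int n) \<le> 1"
    by (intro passage_sum_le_1) (auto simp: laplace_pos laplace_le_1 df less_imp_le)
  then have "passage_sum (laplace \<phi>) (int n) < \<top>"
    by (rule order.strict_trans1) simp
  then show ?thesis by (simp add: passage_prob_def)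
qed

lemma passage_prob_le_1: "passage_prob \<phi> n \<le> 1"
proof -
  have "ennreal (passage_prob \<phi> n) \<le> 1"
    unfolding ennreal_passage_prob
    by (intro passage_sum_le_1) (auto simp: laplace_pos laplace_le_1 df less_imp_le)
  then show ?thesis by simp
qed

text \<open>The path that steps only to the right contributes a positive term.\<close>

lemma passage_prob_pos: "0 < passage_prob \<phi> n"
proof -
  define \<gamma> where "\<gamma> = replicate n (1::int)"
  have "\<gamma> \<in> first_passage (int n)"
    by (auto simp: first_passage_def \<gamma>_def sum_list_replicate)
  then have "ennreal ((1/2) ^ length \<gamma> * visit_weight (laplace \<phi>) (visited 0 \<gamma>))
      \<le> ennreal (passage_prob \<phi> n)"
    unfolding ennreal_passage_prob passage_sum_def by (rule nn_integral_ge_point)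
  moreover have "0 < (1/2) ^ length \<gamma> * visit_weight (laplace \<phi>) (visited 0 \<gamma>)"
    unfolding visit_weight_def
    by (intro mult_pos_pos prod_pos) (auto simp: laplace_pos df)
  ultimately show ?thesis
    by (simp add: ennreal_le_iff2)
qed

lemma passage_prob_supermultiplicative:
  "passage_prob \<phi> m * passage_prob \<phi> n \<le> passage_prob \<phi> (m + n)"
proof -
  have "ennreal (passage_prob \<phi> m * passage_prob \<phi> n) \<le> ennreal (passage_prob \<phi> (m + n))"
    using passage_sum_supermultiplicative[of "laplace \<phi>" m n]
    by (simp add: ennreal_mult' ennreal_passage_prob passage_prob_pos less_imp_le laplace_pos
        laplace_supermultiplicative laplace_0 df del: of_nat_add)
  then show ?thesis by (simp add: passage_prob_pos less_imp_le)
qed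

lemma annealed_lyapunov_LIMSEQ:
  "(\<lambda>n. - ln (passage_prob \<phi> n) / real n) \<longlonglongrightarrow> annealed_lyapunov \<phi>"
  and annealed_lyapunov_le: "0 < n \<Longrightarrow> annealed_lyapunov \<phi> \<le> - ln (passage_prob \<phi> n) / real n"
proof -
  define b where "b n = - ln (passage_prob \<phi> n)" for n
  have b: "annealed_lyapunov \<phi> = lim (\<lambda>n. b n / real n)"
    by (simp add: annealed_lyapunov_def annealed_cost_eq[OF df] passage_prob_def b_def)
  have nonneg: "0 \<le> b n" for n
    using passage_prob_le_1 passage_prob_pos by (simp add: b_def)
  have sub: "b (m + n) \<le> b m + b n" for m n
  proof -
    have "ln (passage_prob \<phi> m * passage_prob \<phi> n) \<le> ln (passage_prob \<phi> (m + n))"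
      using passage_prob_supermultiplicative passage_prob_pos by simp
    then show ?thesis
      using passage_prob_pos[of m] passage_prob_pos[of n] by (simp add: b_def ln_mult)
  qed
  note lim = fekete[OF nonneg sub]
  have eq: "annealed_lyapunov \<phi> = (INF n\<in>{1..}. b n / real n)"
    unfolding b using lim(1) by (rule limI)
  show "(\<lambda>n. - ln (passage_prob \<phi> n) / real n) \<longlonglongrightarrow> annealed_lyapunov \<phi>"
    using lim(1) unfolding eq by (simp add: b_def)
  show "annealed_lyapunov \<phi> \<le> - ln (passage_prob \<phi> n) / real n" if "0 < n"
    using lim(2)[OF that] unfolding eq by (simp add: b_def)
qed

lemma annealed_lyapunov_nonneg: "0 \<le> annealed_lyapunov \<phi>"
proof (rule LIMSEQ_le_const[OF annealed_lyapunov_LIMSEQ], intro exI allI impI)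
  fix n
  have "ln (passage_prob \<phi> n) \<le> 0"
    using passage_prob_le_1[of n] passage_prob_pos[of n] by simp
  then show "0 \<le> - ln (passage_prob \<phi> n) / real n" by (simp add: divide_nonpos_nonneg)
qed

lemma passage_prob_le_exp:
  assumes "0 < n"
  shows "passage_prob \<phi> n \<le> exp (- annealed_lyapunov \<phi>) ^ n"
proof -
  have "ln (passage_prob \<phi> n) \<le> real n * (- annealed_lyapunov \<phi>)"
    using annealed_lyapunov_le[OF assms] assms by (simp add: field_simps)
  then have "exp (ln (passage_prob \<phi> n)) \<le> exp (real n * (- annealed_lyapunov \<phi>))" by simp
  then show ?thesis using passage_prob_pos by (simp only: exp_of_nat_mult exp_ln)
qed

end

lemma annealed_lyapunov_ge:
  assumes \<phi>: "distribution_function \<phi>" and r: "0 < r" and C: "0 < C"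
    and le: "\<And>n. 0 < n \<Longrightarrow> passage_prob \<phi> n \<le> C * r ^ n"
  shows "- ln r \<le> annealed_lyapunov \<phi>"
proof -
  have "(\<lambda>n. - (ln C / real n) - ln r) \<longlonglongrightarrow> - 0 - ln r"
    by (intro tendsto_intros tendsto_divide_0[OF tendsto_const] filterlim_at_top_imp_at_infinity
        filterlim_real_sequentially)
  moreover have "- (ln C / real n) - ln r \<le> - ln (passage_prob \<phi> n) / real n" if "1 \<le> n" for n
  proof -
    have "ln (passage_prob \<phi> n) \<le> ln (C * r ^ n)"
      using le[of n] that passage_prob_pos[OF \<phi>, of n] by (subst ln_le_cancel_iff) (auto simp: r C)
    also have "\<dots> = ln C + real n * ln r" using r C by (simp add: ln_mult ln_realpow)
    finally have "ln (passage_prob \<phi> n) / real n \<le> (ln C + real n * ln r) / real n"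
      by (rule divide_right_mono) simp
    then show ?thesis using that by (simp add: add_divide_distrib)
  qed
  ultimately show ?thesis
    using LIMSEQ_le[OF _ annealed_lyapunov_LIMSEQ[OF \<phi>]] by fastforce
qed

lemma annealed_lyapunov_upper:
  assumes \<phi>: "distribution_function \<phi>" and r: "0 < r"
    and ge: "\<And>n. r ^ n / real (n + 1) \<le> passage_prob \<phi> n"
  shows "annealed_lyapunov \<phi> \<le> - ln r"
proof -
  have "(\<lambda>n. ln (real (n + 1)) / real n - ln r) \<longlonglongrightarrow> 0 - ln r"
    by (intro tendsto_intros) real_asymp
  moreover have "- ln (passage_prob \<phi> n) / real n \<le> ln (real (n + 1)) / real n - ln r" if "1 \<le> n" for n
  proof -
    have "ln (r ^ n / real (n + 1)) \<le> ln (passage_prob \<phi> n)"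
      using ge[of n] r passage_prob_pos[OF \<phi>, of n] by (subst ln_le_cancel_iff) auto
    then have "real n * ln r - ln (real (n + 1)) \<le> ln (passage_prob \<phi> n)"
      using r by (simp add: ln_div ln_realpow del: of_nat_add of_nat_Suc)
    then have "(real n * ln r - ln (real (n + 1))) / real n \<le> ln (passage_prob \<phi> n) / real n"
      by (rule divide_right_mono) simp
    then show ?thesis using that by (simp add: diff_divide_distrib)
  qed
  ultimately show ?thesis
    using LIMSEQ_le[OF annealed_lyapunov_LIMSEQ[OF \<phi>]] by fastforce
qed

section \<open>The atom at zero bounds the exponent from above\<close>

text \<open>First passages to \<open>n\<close> from \<open>x\<close> in at most \<open>k\<close> steps that avoid the negative half-line. The
  bound on the number of steps makes these sets finite and gives the recursion.\<close>

fun confined_passages :: "nat \<Rightarrow> nat \<Rightarrow> int \<Rightarrow> int list set" where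
  "confined_passages n 0 x = (if x = int n then {[]} else {})"
| "confined_passages n (Suc k) x =
     (if x = int n then {[]} else if x < 0 then {}
      else (#) 1 ` confined_passages n k (x + 1) \<union> (#) (-1) ` confined_passages n k (x - 1))"

lemma finite_confined_passages: "finite (confined_passages n k x)"
  by (induction k arbitrary: x) auto

lemma confined_passages_sound:
  assumes "\<gamma> \<in> confined_passages n k x" "x \<le> int n"
  shows "set \<gamma> \<subseteq> {-1, 1} \<and> x + sum_list \<gamma> = int n \<and>
    (\<forall>j<length \<gamma>. x + sum_list (take j \<gamma>) \<noteq> int n) \<and> set (visited x \<gamma>) \<subseteq> {0..<int n}"
  using assms
proof (induction k arbitrary: x \<gamma>)
  case (Suc k)
  show ?case
  proof (cases "x = int n")
    case True
    with Suc.prems show ?thesis by simp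
  next
    case False
    with Suc.prems obtain s \<delta> where \<gamma>: "\<gamma> = s # \<delta>" "s \<in> {-1, 1}"
      "\<delta> \<in> confined_passages n k (x + s)" and x: "0 \<le> x" "x < int n"
      by (auto split: if_splits)
    have IH: "set \<delta> \<subseteq> {-1, 1} \<and> (x + s) + sum_list \<delta> = int n \<and>
      (\<forall>j<length \<delta>. (x + s) + sum_list (take j \<delta>) \<noteq> int n) \<and> set (visited (x + s) \<delta>) \<subseteq> {0..<int n}"
      using \<gamma> x by (intro Suc.IH) auto
    moreover have "x + sum_list (take j \<gamma>) \<noteq> int n" if "j < length \<gamma>" for j
      using IH that \<gamma>(1) x by (cases j) (auto simp: add.assoc)
    ultimately show ?thesis using \<gamma> x by (auto simp: add.assoc)
  qed
qed (auto split: if_splits)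

text \<open>Gambler's ruin. The harmonic function \<open>(x + 1) / (n + 1)\<close> is the probability of reaching \<open>n\<close>
  before \<open>-1\<close>. The error made by allowing only \<open>k\<close> steps is controlled by
  \<open>v(x) = (x + 1) (n - x)\<close>: averaging \<open>v\<close> over one step lowers it by 1, and since \<open>v\<close> is at most
  \<open>(n + 1)\<^sup>2\<close>, this is a decrease at least by the factor \<open>\<theta>\<close>.\<close>

lemma confined_passages_weight:
  fixes n :: nat
  defines "\<theta> \<equiv> 1 - 1 / (real n + 1)\<^sup>2"
  assumes "-1 \<le> x" "x \<le> int n"
  shows "(of_int x + 1) / (real n + 1) - \<theta> ^ k * ((of_int x + 1) * (real n - of_int x))
    \<le> (\<Sum>\<gamma>\<in>confined_passages n k x. (1/2) ^ length \<gamma>)"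
  using assms(2-)
proof (induction k arbitrary: x)
  case 0
  show ?case
  proof (cases "x = int n")
    case False
    with 0 have x: "0 \<le> of_int x + (1::real)" "1 \<le> real n - of_int x" by linarith+
    have "(of_int x + 1) / (real n + 1) \<le> of_int x + 1"
      using x(1) mult_left_mono[of 1 "real n + 1" "of_int x + 1"] by (simp add: divide_le_eq)
    also have "\<dots> \<le> (of_int x + 1) * (real n - of_int x)"
      using mult_left_mono[OF x(2) x(1)] by simp
    finally show ?thesis using False by simp
  qed simp
next
  case (Suc k)
  show ?case
  proof (cases "x = int n \<or> x = -1")
    case True
    then show ?thesis by auto
  next
    case False
    with Suc.prems have x: "0 \<le> x" "x < int n" by auto
    define h v :: "real \<Rightarrow> real" where "h u = (u + 1) / (real n + 1)"
      and "v u = (u + 1) * (real n - u)" for u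
    let ?S = "\<lambda>k x. \<Sum>\<gamma>\<in>confined_passages n k x. (1/2 :: real) ^ length \<gamma>"
    let ?x = "of_int x :: real"
    have split: "?S (Suc k) x = (?S k (x + 1) + ?S k (x - 1)) / 2"
    proof -
      have "?S (Suc k) x = (\<Sum>\<gamma>\<in>(#) 1 ` confined_passages n k (x + 1). (1/2) ^ length \<gamma>) +
          (\<Sum>\<gamma>\<in>(#) (-1) ` confined_passages n k (x - 1). (1/2) ^ length \<gamma>)"
        using x by (simp, subst sum.union_disjoint) (auto simp: finite_confined_passages)
      also have "\<dots> = (\<Sum>\<gamma>\<in>confined_passages n k (x + 1). (1/2) ^ length \<gamma> / 2) +
          (\<Sum>\<gamma>\<in>confined_passages n k (x - 1). (1/2) ^ length \<gamma> / 2)"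
        by (subst (1 2) sum.reindex) (auto simp: o_def)
      finally show ?thesis by (simp add: sum_divide_distrib add_divide_distrib)
    qed
    have IH: "h (?x + 1) - \<theta> ^ k * v (?x + 1) \<le> ?S k (x + 1)"
      "h (?x - 1) - \<theta> ^ k * v (?x - 1) \<le> ?S k (x - 1)"
      using Suc.IH[of "x + 1"] Suc.IH[of "x - 1"] x by (simp_all add: h_def v_def)
    have \<theta>: "0 \<le> \<theta>"
      unfolding \<theta>_def using one_le_power[of "real n + 1" 2] by simp
    have "v ?x \<le> (real n + 1) * (real n + 1)"
      unfolding v_def using x by (intro mult_mono) auto
    then have "v ?x / (real n + 1)\<^sup>2 \<le> 1"
      by (subst pos_divide_le_eq) (simp_all add: power2_eq_square)
    then have "v ?x - 1 \<le> \<theta> * v ?x"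
      unfolding \<theta>_def by (simp add: left_diff_distrib)
    then have "\<theta> ^ k * (v ?x - 1) \<le> \<theta> ^ Suc k * v ?x"
      using mult_left_mono[of "v ?x - 1" "\<theta> * v ?x" "\<theta> ^ k"] \<theta> by (simp add: ac_simps)
    then have "h ?x - \<theta> ^ Suc k * v ?x \<le> h ?x - \<theta> ^ k * (v ?x - 1)" by (rule diff_left_mono)
    also have "\<dots> = ((h (?x + 1) - \<theta> ^ k * v (?x + 1)) + (h (?x - 1) - \<theta> ^ k * v (?x - 1))) / 2"
    proof -
      have "h (?x + 1) + h (?x - 1) = 2 * h ?x"
        by (simp add: h_def add_divide_distrib diff_divide_distrib)
      then have h: "h ?x = (h (?x + 1) + h (?x - 1)) / 2" by simp
      have v: "v ?x - 1 = (v (?x + 1) + v (?x - 1)) / 2"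
        by (simp add: v_def algebra_simps)
      show ?thesis
        by (subst h, subst v) (simp add: distrib_left diff_divide_distrib add_divide_distrib)
    qed
    also have "\<dots> \<le> ?S (Suc k) x"
      unfolding split using IH by (intro divide_right_mono add_mono) simp_all
    finally have "h ?x - \<theta> ^ Suc k * v ?x \<le> ?S (Suc k) x" .
    then show ?thesis by (simp add: h_def v_def)
  qed
qed

text \<open>A confined path visits at most the \<open>n\<close> sites from 0 to \<open>n - 1\<close>, and each of them has potential
  zero with probability \<open>\<phi> 0\<close>.\<close>

lemma confined_weight_le_passage_prob:
  assumes \<phi>: "distribution_function \<phi>"
  shows "\<phi> 0 ^ n * (\<Sum>\<gamma>\<in>confined_passages n k 0. (1/2) ^ length \<gamma>) \<le> passage_prob \<phi> n"
proof -
  let ?C = "confined_passages n k 0"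
  define f where "f \<gamma> = (1/2) ^ length \<gamma> * visit_weight (laplace \<phi>) (visited 0 \<gamma>)" for \<gamma>
  have f0: "0 \<le> f \<gamma>" for \<gamma>
    unfolding f_def by (simp add: visit_weight_nonneg laplace_pos[OF \<phi>] less_imp_le)
  have sub: "?C \<subseteq> first_passage (int n)"
    using confined_passages_sound[of _ n k 0] by (auto simp: first_passage_def)
  have weight: "\<phi> 0 ^ n \<le> visit_weight (laplace \<phi>) (visited 0 \<gamma>)" if "\<gamma> \<in> ?C" for \<gamma>
  proof -
    have "set (visited 0 \<gamma>) \<subseteq> {0..<int n}"
      using confined_passages_sound[OF that] by simp
    then have "card (set (visited 0 \<gamma>)) \<le> n"
      using card_mono[of "{0..<int n}"] by fastforce
    then have "\<phi> 0 ^ n \<le> (\<Prod>x\<in>set (visited 0 \<gamma>). \<phi> 0)"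
      using distribution_function_range[OF \<phi>] by (simp add: power_decreasing)
    also have "\<dots> \<le> visit_weight (laplace \<phi>) (visited 0 \<gamma>)"
      unfolding visit_weight_def
      by (intro prod_mono) (simp add: distribution_function_range laplace_ge_atom \<phi>)
    finally show ?thesis .
  qed
  have "ennreal (\<Sum>\<gamma>\<in>?C. f \<gamma>) = (\<Sum>\<gamma>\<in>?C. ennreal (f \<gamma>))"
    using f0 by (subst sum_ennreal) auto
  also have "\<dots> = (\<integral>\<^sup>+\<gamma>. ennreal (f \<gamma>) * indicator ?C \<gamma> \<partial>count_space (first_passage (int n)))"
    using sub by (subst nn_integral_count_space'[of ?C]) (auto simp: finite_confined_passages)
  also have "\<dots> \<le> ennreal (passage_prob \<phi> n)"
    unfolding ennreal_passage_prob[OF \<phi>] passage_sum_def f_def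
    by (intro nn_integral_mono) (simp add: indicator_def)
  finally have "(\<Sum>\<gamma>\<in>?C. f \<gamma>) \<le> passage_prob \<phi> n"
    using passage_prob_pos[OF \<phi>, of n] by (simp add: ennreal_le_iff)
  moreover have "\<phi> 0 ^ n * (\<Sum>\<gamma>\<in>?C. (1/2) ^ length \<gamma>) \<le> (\<Sum>\<gamma>\<in>?C. f \<gamma>)"
    unfolding sum_distrib_left f_def
    by (intro sum_mono) (use weight in \<open>simp add: mult.commute\<close>)
  ultimately show ?thesis by linarith
qed

text \<open>The walk reaches \<open>n\<close> before \<open>-1\<close> with probability \<open>1 / (n + 1)\<close>, which is subexponential in
  \<open>n\<close>, so confining the walk costs nothing on the exponential scale.\<close>

lemma passage_prob_ge_atom:
  assumes \<phi>: "distribution_function \<phi>"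
  shows "\<phi> 0 ^ n / real (n + 1) \<le> passage_prob \<phi> n"
proof (rule LIMSEQ_le_const2)
  define \<theta> where "\<theta> = 1 - 1 / (real n + 1)\<^sup>2"
  have "0 < (real n + 1)\<^sup>2" "1 \<le> (real n + 1)\<^sup>2" by simp_all
  then have "0 \<le> \<theta>" "\<theta> < 1" by (simp_all add: \<theta>_def)
  then have "(\<lambda>k. \<theta> ^ k) \<longlonglongrightarrow> 0" by (rule LIMSEQ_realpow_zero)
  then have "(\<lambda>k. \<theta> ^ k * real n) \<longlonglongrightarrow> 0 * real n" by (rule tendsto_mult_right)
  then have "(\<lambda>k. \<phi> 0 ^ n * (1 / (real n + 1) - \<theta> ^ k * real n))
      \<longlonglongrightarrow> \<phi> 0 ^ n * (1 / (real n + 1) - 0 * real n)"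
    by (rule tendsto_mult[OF tendsto_const tendsto_diff[OF tendsto_const]])
  then show "(\<lambda>k. \<phi> 0 ^ n * (1 / (real n + 1) - \<theta> ^ k * real n)) \<longlonglongrightarrow> \<phi> 0 ^ n / real (n + 1)"
    by (simp add: add.commute)
  have "\<phi> 0 ^ n * (1 / (real n + 1) - \<theta> ^ k * real n) \<le> passage_prob \<phi> n" for k
  proof -
    have "\<phi> 0 ^ n * (1 / (real n + 1) - \<theta> ^ k * real n) \<le>
        \<phi> 0 ^ n * (\<Sum>\<gamma>\<in>confined_passages n k 0. (1/2) ^ length \<gamma>)"
      using confined_passages_weight[of 0 n k] distribution_function_range(1)[OF \<phi>, of 0]
      by (intro mult_left_mono) (simp_all add: \<theta>_def)
    also note confined_weight_le_passage_prob[OF \<phi>]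
    finally show ?thesis .
  qed
  then show "\<exists>N. \<forall>k\<ge>N. \<phi> 0 ^ n * (1 / (real n + 1) - \<theta> ^ k * real n) \<le> passage_prob \<phi> n"
    by blast
qed

lemma annealed_lyapunov_le_atom:
  assumes "distribution_function \<phi>" "0 < \<phi> 0"
  shows "annealed_lyapunov \<phi> \<le> - ln (\<phi> 0)"
  using assms by (intro annealed_lyapunov_upper passage_prob_ge_atom)

section \<open>Strict monotonicity\<close>

text \<open>Two different effects make a visited site costlier under \<open>F\<close>. For at most \<open>M\<close> visits the two
  transforms differ by a uniform factor \<open>\<rho> < 1\<close>, but this factor may degenerate as the number of
  visits grows. For more than \<open>M\<close> visits the transform of \<open>F\<close> is close to \<open>F 0\<close>, hence below
  \<open>exp (- \<beta>)\<close>, in the application the decay rate per unit distance under \<open>G\<close>. A geometric mean of the transform of \<open>G\<close> and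
  \<open>exp (- \<beta>)\<close> is beaten by a fixed factor in both cases.\<close>

lemma laplace_gap:
  assumes F: "distribution_function F" and G: "distribution_function G"
    and dom: "strictly_dominates F G" and \<beta>: "0 \<le> \<beta>" and atom: "F 0 < exp (- \<beta>)"
  obtains \<sigma> \<theta> :: real where "0 < \<sigma>" "\<sigma> < 1" "0 < \<theta>" "\<theta> < 1"
    "\<And>k. 0 < k \<Longrightarrow> laplace F k \<le> \<sigma> * exp (- \<beta>) powr (1 - \<theta>) * laplace G k powr \<theta>"
proof -
  define c where "c = exp (- \<beta>)"
  have c: "0 < c" by (simp add: c_def)
  have le: "dist_le F G" using dom by (simp add: strictly_dominates_def)
  note posF = laplace_pos[OF F] and posG = laplace_pos[OF G]
  have "\<forall>\<^sub>F k in sequentially. laplace F k < c"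
    using laplace_tendsto_atom[OF F] atom unfolding c_def by (rule order_tendstoD)
  then obtain N where "laplace F k < c" if "N \<le> k" for k
    by (auto simp: eventually_sequentially)
  then obtain M where M: "0 < M" "laplace F M < c"
    using le_SucI[OF order_refl] zero_less_Suc by blast
  define \<rho> where "\<rho> = Max ((\<lambda>k. laplace F k / laplace G k) ` {1..M})"
  have \<rho>_mem: "\<rho> \<in> (\<lambda>k. laplace F k / laplace G k) ` {1..M}"
    unfolding \<rho>_def using M(1) by (intro Max_in) auto
  then have \<rho>: "0 < \<rho>" "\<rho> < 1"
    using posF posG laplace_strict_mono[OF F G dom] by auto
  have small: "laplace F k \<le> \<rho> * laplace G k" if "0 < k" "k \<le> M" for k
  proof -
    have "laplace F k / laplace G k \<le> \<rho>"
      unfolding \<rho>_def using that by (intro Max_ge) auto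
    then show ?thesis using posG[of k] by (simp add: field_simps)
  qed
  \<comment> \<open>The exponent \<open>\<theta> = 1 - s\<close> is chosen so close to 1 that \<open>\<rho> < c powr s\<close>.\<close>
  define r where "r = - ln \<rho>"
  have r: "0 < r" "\<rho> = exp (- r)" using \<rho> by (simp_all add: r_def)
  define s where "s = r / (1 + \<beta> + r)"
  have d: "0 < 1 + \<beta> + r" using r \<beta> by simp
  then have s: "0 < s" "s < 1" using r \<beta> by (simp_all add: s_def)
  have "\<beta> * r < r * (1 + \<beta> + r)" using r by (simp add: algebra_simps add_pos_pos)
  then have "\<beta> * s < r" using d by (simp add: s_def pos_divide_less_eq)
  then have \<rho>_s: "\<rho> < c powr s"
    unfolding r(2) by (simp add: c_def powr_def mult.commute)
  define \<sigma> where "\<sigma> = max (\<rho> / c powr s) ((laplace F M / c) powr s)"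
  have "laplace F M / c < 1" using M(2) c by simp
  then have "(laplace F M / c) powr s < 1"
    using powr_less_mono2[of s "laplace F M / c" 1] posF[of M] c s by simp
  then have \<sigma>: "0 < \<sigma>" "\<sigma> < 1"
    using \<rho> \<rho>_s c by (auto simp: \<sigma>_def less_max_iff_disj)
  have "laplace F k \<le> \<sigma> * c powr s * laplace G k powr (1 - s)" if k: "0 < k" for k
  proof (cases "k \<le> M")
    case True
    have "laplace G k = laplace G k powr s * laplace G k powr (1 - s)"
      using posG[of k] by (simp add: powr_add[symmetric])
    also have "\<dots> \<le> 1 * laplace G k powr (1 - s)"
      using posG[of k] laplace_le_1[OF G, of k] s by (intro mult_right_mono powr_le1) auto
    finally have G_le: "laplace G k \<le> laplace G k powr (1 - s)" by simp
    have "laplace F k \<le> \<rho> * laplace G k" by (rule small[OF k True])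
    also have "\<dots> \<le> \<rho> * laplace G k powr (1 - s)"
      using \<rho>(1) G_le by (intro mult_left_mono) auto
    also have "\<rho> = (\<rho> / c powr s) * c powr s" using c by simp
    also have "\<dots> \<le> \<sigma> * c powr s" by (intro mult_right_mono) (simp_all add: \<sigma>_def)
    finally show ?thesis by (simp add: mult_right_mono)
  next
    case False
    then have "laplace F k \<le> laplace F M" by (intro laplace_antimono[OF F]) simp
    have "laplace F k = laplace F k powr s * laplace F k powr (1 - s)"
      using posF[of k] by (simp add: powr_add[symmetric])
    also have "\<dots> \<le> laplace F M powr s * laplace G k powr (1 - s)"
      using posF[of k] s \<open>laplace F k \<le> laplace F M\<close> laplace_mono[OF F G le, of k]
      by (intro mult_mono powr_mono2) auto
    also have "laplace F M powr s = (laplace F M / c) powr s * c powr s"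
      using c posF[of M] by (simp add: powr_divide)
    also have "\<dots> \<le> \<sigma> * c powr s"
      by (intro mult_right_mono) (simp_all add: \<sigma>_def)
    finally show ?thesis by (simp add: mult_right_mono)
  qed
  with \<sigma> s show thesis by (intro that[of \<sigma> "1 - s"]) (simp_all add: c_def)
qed

text \<open>The discrete intermediate value theorem.\<close>

lemma first_passage_visits:
  assumes "set \<gamma> \<subseteq> {-1, 1}" "x \<le> y" "y < x + sum_list \<gamma>"
  shows "y \<in> set (visited x \<gamma>)"
  using assms
proof (induction \<gamma> arbitrary: x)
  case (Cons s \<gamma>)
  show ?case
  proof (cases "y = x")
    case False
    with Cons.prems have "x + s \<le> y" by auto
    with Cons show ?thesis by (auto simp: add.assoc)
  qed simp
qed simp

text \<open>Each of the sites \<open>0, \<dots>, n - 1\<close> is visited and contributes the factor \<open>\<sigma>\<close>; elsewhere the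
  comparison is not strict. The product of the geometric means is a geometric mean of the
  \<open>LG\<close>-weight and \<open>c ^ n\<close>, so it is at most their maximum, hence at most their sum. This turns the
  sitewise estimate into one that is linear in the \<open>LG\<close>-weight and can be summed over paths.\<close>

lemma visit_weight_gap:
  fixes LF LG :: "nat \<Rightarrow> real"
  assumes pos: "\<And>k. 0 < LF k" "\<And>k. 0 < LG k" and le: "\<And>k. LF k \<le> LG k" "\<And>k. LG k \<le> 1"
    and c: "0 < c" and \<sigma>: "0 < \<sigma>" and \<theta>: "0 < \<theta>" "\<theta> < 1"
    and gap: "\<And>k. 0 < k \<Longrightarrow> LF k \<le> \<sigma> * c powr (1 - \<theta>) * LG k powr \<theta>"
    and \<gamma>: "\<gamma> \<in> first_passage (int n)"
  shows "visit_weight LF (visited 0 \<gamma>) \<le> \<sigma> ^ n * (visit_weight LG (visited 0 \<gamma>) + c ^ n)"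
proof -
  define V where "V = set (visited 0 \<gamma>)"
  define m where "m x = count_list (visited 0 \<gamma>) x" for x
  let ?I = "{0..<int n}"
  let ?W = "visit_weight LG (visited 0 \<gamma>)"
  have V: "finite V" "?I \<subseteq> V"
    unfolding V_def using first_passage_visits[of \<gamma> 0] \<gamma> by (auto simp: first_passage_def)
  have m: "0 < m x" if "x \<in> V" for x
    using that by (auto simp: V_def m_def count_list_0_iff neq0_conv[symmetric] simp del: neq0_conv)
  have W_pos: "0 < ?W" unfolding visit_weight_def by (intro prod_pos) (simp add: pos)
  have W_powr: "?W powr \<theta> = (\<Prod>x\<in>?I. LG (m x) powr \<theta>) * (\<Prod>x\<in>V - ?I. LG (m x) powr \<theta>)"
  proof -
    have "?W powr \<theta> = (\<Prod>x\<in>V. LG (m x) powr \<theta>)"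
      unfolding visit_weight_def V_def m_def
      by (rule prod_powr_distrib)
    also have "\<dots> = (\<Prod>x\<in>V - ?I. LG (m x) powr \<theta>) * (\<Prod>x\<in>?I. LG (m x) powr \<theta>)"
      by (rule prod.subset_diff) (use V in auto)
    finally show ?thesis by (simp add: mult.commute)
  qed
  have outside: "LF (m x) \<le> LG (m x) powr \<theta>" for x
  proof -
    have "LG (m x) = LG (m x) powr 1" using pos(2)[of "m x"] by simp
    also have "\<dots> \<le> LG (m x) powr \<theta>"
      using \<theta> pos(2)[of "m x"] le(2)[of "m x"] by (intro powr_mono') auto
    finally show ?thesis using le(1)[of "m x"] by simp
  qed
  have "visit_weight LF (visited 0 \<gamma>) = (\<Prod>x\<in>V - ?I. LF (m x)) * (\<Prod>x\<in>?I. LF (m x))"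
    unfolding visit_weight_def V_def[symmetric] m_def[symmetric]
    by (rule prod.subset_diff) (use V in auto)
  also have "\<dots> \<le> (\<Prod>x\<in>V - ?I. LG (m x) powr \<theta>) * (\<Prod>x\<in>?I. \<sigma> * c powr (1 - \<theta>) * LG (m x) powr \<theta>)"
    using V by (intro mult_mono prod_mono prod_nonneg)
      (auto simp: outside gap m less_imp_le[OF pos(1)] \<sigma> less_imp_le)
  also have "\<dots> = \<sigma> ^ n * (?W powr \<theta> * (c powr (1 - \<theta>)) ^ n)"
    unfolding W_powr by (simp add: prod.distrib power_mult_distrib ac_simps)
  also have "(c powr (1 - \<theta>)) ^ n = (c ^ n) powr (1 - \<theta>)"
    using c by (simp add: powr_realpow[symmetric] powr_powr mult.commute)
  also have "?W powr \<theta> * (c ^ n) powr (1 - \<theta>) \<le> ?W + c ^ n"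
  proof -
    define z where "z = max ?W (c ^ n)"
    have "?W powr \<theta> * (c ^ n) powr (1 - \<theta>) \<le> z powr \<theta> * z powr (1 - \<theta>)"
      using W_pos c \<theta> by (intro mult_mono powr_mono2) (auto simp: z_def)
    also have "\<dots> = z" using W_pos by (simp add: powr_add[symmetric] z_def)
    also have "\<dots> \<le> ?W + c ^ n" using W_pos c by (simp add: z_def less_imp_le)
    finally show ?thesis .
  qed
  finally show ?thesis using \<sigma> by (simp add: mult_left_mono)
qed

lemma annealed_lyapunov_mono:
  assumes F: "distribution_function F" and G: "distribution_function G" and le: "dist_le F G"
  shows "annealed_lyapunov G \<le> annealed_lyapunov F"
proof -
  have "passage_prob F n \<le> passage_prob G n" for n
  proof -
    have "ennreal (passage_prob F n) \<le> ennreal (passage_prob G n)"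
      unfolding ennreal_passage_prob[OF F] ennreal_passage_prob[OF G]
      unfolding passage_sum_def visit_weight_def
      using laplace_mono[OF F G le] laplace_pos[OF F]
      by (intro nn_integral_mono ennreal_leI mult_left_mono prod_mono) (auto intro: less_imp_le)
    then show ?thesis using passage_prob_pos[OF G, of n] by (simp add: ennreal_le_iff)
  qed
  then have "passage_prob F n \<le> 1 * exp (- annealed_lyapunov G) ^ n" if "0 < n" for n
    using passage_prob_le_exp[OF G that] by (metis mult_1 order_trans)
  from annealed_lyapunov_ge[OF F _ _ this] show ?thesis by simp
qed

text \<open>Let \<open>c = exp (- \<beta>)\<close>, where \<open>\<beta>\<close> is the exponent of \<open>G\<close>. Summing \<open>visit_weight_gap\<close> over all
  paths bounds the passage probability under \<open>F\<close> by \<open>\<sigma> ^ n (a + c ^ n)\<close>, where \<open>a\<close> is the one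
  under \<open>G\<close>. Superadditivity bounds \<open>a\<close> by \<open>c ^ n\<close> for every \<open>n > 0\<close>, so the exponent grows by at
  least \<open>- ln \<sigma>\<close>.\<close>

lemma annealed_lyapunov_strict_mono:
  assumes F: "distribution_function F" and G: "distribution_function G"
    and dom: "strictly_dominates F G" and atom: "F 0 < exp (- annealed_lyapunov G)"
  shows "annealed_lyapunov G < annealed_lyapunov F"
proof -
  define c where "c = exp (- annealed_lyapunov G)"
  have le: "dist_le F G" using dom by (simp add: strictly_dominates_def)
  obtain \<sigma> \<theta> where \<sigma>: "0 < \<sigma>" "\<sigma> < 1" and \<theta>: "0 < \<theta>" "\<theta> < 1"
    and gap: "\<And>k. 0 < k \<Longrightarrow> laplace F k \<le> \<sigma> * c powr (1 - \<theta>) * laplace G k powr \<theta>"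
    using laplace_gap[OF F G dom annealed_lyapunov_nonneg[OF G] atom] unfolding c_def by metis
  have bound: "passage_prob F n \<le> 2 * (\<sigma> * c) ^ n" if n: "0 < n" for n
  proof -
    let ?W = "\<lambda>\<gamma>. visit_weight (laplace G) (visited 0 \<gamma>)"
    have W: "0 \<le> ?W \<gamma>" for \<gamma>
      by (simp add: visit_weight_nonneg laplace_pos[OF G] less_imp_le)
    have "ennreal (passage_prob F n) \<le> (\<integral>\<^sup>+\<gamma>. ennreal (\<sigma> ^ n) *
        (ennreal ((1/2) ^ length \<gamma> * ?W \<gamma>) + ennreal (c ^ n) * ennreal ((1/2) ^ length \<gamma>))
        \<partial>count_space (first_passage (int n)))"
      unfolding ennreal_passage_prob[OF F] passage_sum_def
    proof (rule nn_integral_mono)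
      fix \<gamma> assume "\<gamma> \<in> space (count_space (first_passage (int n)))"
      then have "visit_weight (laplace F) (visited 0 \<gamma>) \<le> \<sigma> ^ n * (?W \<gamma> + c ^ n)"
        using \<sigma> \<theta> gap laplace_mono[OF F G le] laplace_le_1[OF G]
        by (intro visit_weight_gap[where \<theta> = \<theta> and c = c]) (auto simp: laplace_pos F G c_def)
      then have "(1/2) ^ length \<gamma> * visit_weight (laplace F) (visited 0 \<gamma>) \<le>
          (1/2) ^ length \<gamma> * (\<sigma> ^ n * (?W \<gamma> + c ^ n))"
        by (rule mult_left_mono) simp
      also have "\<dots> = \<sigma> ^ n * ((1/2) ^ length \<gamma> * ?W \<gamma> + c ^ n * (1/2) ^ length \<gamma>)"
        by (simp add: algebra_simps)
      finally show "ennreal ((1/2) ^ length \<gamma> * visit_weight (laplace F) (visited 0 \<gamma>)) \<le>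
          ennreal (\<sigma> ^ n) * (ennreal ((1/2) ^ length \<gamma> * ?W \<gamma>) +
            ennreal (c ^ n) * ennreal ((1/2) ^ length \<gamma>))"
        using \<sigma> W[of \<gamma>]
        by (simp only: ennreal_mult[symmetric] ennreal_plus[symmetric] c_def
            zero_le_power exp_ge_zero less_imp_le mult_nonneg_nonneg add_nonneg_nonneg
            zero_le_divide_1_iff zero_le_numeral ennreal_leI)
    qed
    also have "\<dots> = ennreal (\<sigma> ^ n) * (passage_sum (laplace G) (int n) + ennreal (c ^ n) *
        (\<integral>\<^sup>+\<gamma>. ennreal ((1/2) ^ length \<gamma>) \<partial>count_space (first_passage (int n))))"
      unfolding passage_sum_def by (simp add: nn_integral_cmult nn_integral_add)
    also have "\<dots> \<le> ennreal (\<sigma> ^ n) * (ennreal (c ^ n) + ennreal (c ^ n) * 1)"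
      using passage_prob_le_exp[OF G n]
      by (intro mult_left_mono add_mono first_passage_weight_le_1)
         (auto simp: ennreal_passage_prob[OF G, symmetric] c_def intro!: ennreal_leI)
    also have "\<dots> = ennreal (2 * (\<sigma> * c) ^ n)"
      using \<sigma> by (simp add: c_def ennreal_mult[symmetric] ennreal_plus[symmetric] power_mult_distrib
          del: ennreal_plus)
    finally show ?thesis using \<sigma> by (simp add: ennreal_le_iff c_def)
  qed
  have "- ln (\<sigma> * c) \<le> annealed_lyapunov F"
    using \<sigma> by (intro annealed_lyapunov_ge[OF F _ _ bound]) (auto simp: c_def)
  moreover have "- ln (\<sigma> * c) = annealed_lyapunov G - ln \<sigma>"
    using \<sigma> by (simp add: ln_mult c_def)
  ultimately show ?thesis using \<sigma> ln_less_zero[of \<sigma>] by linarith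
qed

section \<open>The criterion\<close>

theorem proposition6p1:
  fixes F G :: "real \<Rightarrow> real"
  assumes "distribution_function F" and "distribution_function G"
  shows
    "(dist_le F G \<and> F 0 \<ge> exp (- annealed_lyapunov G) \<longrightarrow>
        - ln (F 0) = annealed_lyapunov F \<and>
        annealed_lyapunov F = annealed_lyapunov G \<and>
        annealed_lyapunov G = - ln (G 0)) \<and>
     (strictly_dominates F G \<longrightarrow>
        (annealed_lyapunov F > annealed_lyapunov G \<longleftrightarrow> F 0 < exp (- annealed_lyapunov G))) \<and>
     (strictly_dominates F G \<and> F 0 < G 0 \<longrightarrow> annealed_lyapunov F > annealed_lyapunov G) \<and>
     (strictly_dominates F G \<and> F 0 = 0 \<longrightarrow> annealed_lyapunov F > annealed_lyapunov G)"
proof -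
  note F = assms(1) and G = assms(2)
  \<comment> \<open>The chain \<open>- ln (F 0) \<le> \<beta>\<^sub>G \<le> \<beta>\<^sub>F \<le> - ln (F 0)\<close> collapses, and \<open>\<beta>\<^sub>G \<le> - ln (G 0) \<le> - ln (F 0)\<close> lies in it.\<close>
  have eq: "- ln (F 0) = annealed_lyapunov F \<and> annealed_lyapunov F = annealed_lyapunov G \<and>
      annealed_lyapunov G = - ln (G 0)"
    if le: "dist_le F G" and atom: "exp (- annealed_lyapunov G) \<le> F 0"
  proof -
    have F0: "0 < F 0" using atom exp_gt_zero[of "- annealed_lyapunov G"] by linarith
    have FG: "F 0 \<le> G 0" using le by (simp add: dist_le_def)
    then have G0: "0 < G 0" using F0 by simp
    have "- ln (F 0) \<le> annealed_lyapunov G"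
      using ln_mono[OF atom exp_gt_zero] by simp
    moreover have "ln (F 0) \<le> ln (G 0)" using FG F0 G0 by simp
    moreover note annealed_lyapunov_mono[OF F G le]
      annealed_lyapunov_le_atom[OF F F0] annealed_lyapunov_le_atom[OF G G0]
    ultimately show ?thesis by linarith
  qed
  have iff: "annealed_lyapunov G < annealed_lyapunov F \<longleftrightarrow> F 0 < exp (- annealed_lyapunov G)"
    if dom: "strictly_dominates F G"
  proof
    assume "annealed_lyapunov G < annealed_lyapunov F"
    with eq dom show "F 0 < exp (- annealed_lyapunov G)"
      by (force simp: strictly_dominates_def not_le[symmetric])
  qed (rule annealed_lyapunov_strict_mono[OF F G dom])
  have strict: "annealed_lyapunov G < annealed_lyapunov F"
    if dom: "strictly_dominates F G" and less: "F 0 < G 0"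
  proof -
    have "0 < G 0" using less distribution_function_range(1)[OF F, of 0] by simp
    then have "ln (G 0) \<le> - annealed_lyapunov G"
      using annealed_lyapunov_le_atom[OF G] by simp
    then have "G 0 \<le> exp (- annealed_lyapunov G)"
      using \<open>0 < G 0\<close> by (metis exp_le_cancel_iff exp_ln)
    with less iff[OF dom] show ?thesis by simp
  qed
  show ?thesis using eq iff strict by auto
qed

end
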